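(* Let $(\Gamma,\psi)$ be a totally reduced GBS graph with one qc-class $Q$ such that $\mathrm{supp}_{\mathrm{qc}}(Q)\ne\emptyset$, and suppose that $(\Gamma,\psi)$ is clean and does not have floating pieces. Then the multi-set of rigid vectors of $(\Gamma,\psi)$ is invariant under edge sign-changes, slides and connections; that is, if a clean GBS graph $(\Gamma',\psi')$ is obtained from $(\Gamma,\psi)$ by an edge sign-change, a slide or a connection, then $(\Gamma,\psi)$ and $(\Gamma',\psi')$ have the same multi-set of rigid vectors.
   Context: A graph (in the sense of Serre) has a vertex set $V$, an edge set $E$, a fixed-point-free involution $e\mapsto\bar e$ on $E$, an initial-vertex map $\iota:E\to V$, and $\tau(e)=\iota(\bar e)$. A GBS graph $(\Gamma,\psi)$ is a finite connected graph $\Gamma$ with a function $\psi:E(\Gamma)\to\mathbb Z\setminus\{0\}$; it encodes the graph of groups with all vertex and edge groups $\mathbb Z$ and edge maps $G_e\to G_{\tau(e)}$ given by multiplication by $\psi(e)$, and its GBS group is the fundamental group. It is totally reduced if it has the minimal number of vertices and edges among GBS graphs with isomorphic GBS group. Let $\mathcal P$ be the finite set of primes dividing some $\psi(e)$, and $\mathbf A=\mathbb Z/2\mathbb Z\oplus\bigoplus_{r\in\mathcal P}\mathbb Z$. For $\mathbf a=(a_0,(a_r)_r)\in\mathbf A$ write $\mathbf a\ge\mathbf 0$ if $a_r\ge0$ for all $r\in\mathcal P$ (no condition on $a_0$); $\mathbf A^+=\{\mathbf a\ge\mathbf 0\}$; $\mathrm{supp}(\mathbf a)=\{r\in\mathcal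 P:a_r\ne0\}$; $\boldsymbol\varepsilon\in\mathbf A$ is the element of order 2. The affine representation $\Lambda$ is the graph with $V(\Lambda)=V(\Gamma)\times\mathbf A^+$, $E(\Lambda)=E(\Gamma)$, same reverse map, and $\tau_\Lambda(e)=(\tau_\Gamma(e),(a_0,(a_r)_r))$ where $\psi(e)=(-1)^{a_0}\prod_r r^{a_r}$. Below $\iota(e),\tau(e)$ denote endpoints in $\Lambda$. Put $(v,\mathbf a)+\mathbf w=(v,\mathbf a+\mathbf w)$, and $p\le p'$ if $p'=p+\mathbf w$ with $\mathbf w\in\mathbf A^+$. An affine path from $p$ to $p'$ is a sequence of edges $(e_1,\dots,e_\ell)$, $\ell\ge0$, for which there are $\mathbf w_i\in\mathbf A^+$ with $\iota(e_1)+\mathbf w_1=p$, $\tau(e_\ell)+\mathbf w_\ell=p'$, $\tau(e_i)+\mathbf w_i=\iota(e_{i+1})+\mathbf w_{i+1}$. Write $p\sim_{\mathrm c}q$ if there is an affine path from $p$ to $q$; $p\preceq_{\mathrm c}q$ if $p\le q'$ for some $q'\sim_{\mathrm c}q$; $p\sim_{\mathrm{qc}}q$ (quasi-conjugate) if $p\preceq_{\mathrm c}q$ and $q\preceq_{\mathrm c}p$. For a quasi-conjugacy class $Q$ and $p\in Q$: the minimal points are $\mathrm{min}_{\mathrm{qc}}(Q)=\{q\in Q:\forall q'\in Q,\ q'\le q\Rightarrow q\le q'\}$; $\mathrm{supp}_{\mathrm{qc}}(Q)=\bigcup\{\mathrm{supp}(\mathbf u):\mathbf u\in\mathbf A^+,\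 p+\mathbf u\sim_{\mathrm{qc}}p\}$. $(\Gamma,\psi)$ has one qc-class $Q$ if all endpoints of edges lie in $Q$. Convention: minimal points $m$ and $m+\boldsymbol\varepsilon$ are identified and treated as one minimal point (so they are not distinct); an endpoint is "at $m$" if it equals $m$ or $m+\boldsymbol\varepsilon$. An edge and its reverse count as one edge. $(\Gamma,\psi)$ is clean if every minimal point contains exactly one endpoint of exactly one edge and no edge has both endpoints at minimal points. It has floating pieces if it has strictly more edges than minimal points. For a clean GBS graph without floating pieces, a rigid cycle is a (cyclic) sequence of $\ell\ge1$ edges $e_1,\dots,e_\ell$ with $\iota(e_i)=m_i$ and $\tau(e_i)=m_{i+1}+\mathbf w_i$ for $1\le i<\ell$, $\tau(e_\ell)=m_1+\mathbf w_\ell$, where $m_1,\dots,m_\ell$ are pairwise distinct minimal points, $\mathbf w_1,\dots,\mathbf w_\ell\in\mathbf A^+$, and there are no distinct minimal points $m,m'$ with $m+\mathbf w_1+\dots+\mathbf w_\ell\ge m'$ (here the representative of the minimal point $m_i$ is the actual point $\iota(e_i)$). Its rigid vector is $\mathbf w=\mathbf w_1+\dots+\mathbf w_\ell\in\mathbf A^+$. The multi-set of rigid vectors of $(\Gamma,\psi)$ consists of the rigid vectors of all its rigid cycles, where sequences differing by cyclic rotation are the same cycle. Moves ($p\,\text{---}\,q$ denotes an edge of $\Lambda$ with endpoints $p,q$; when two edges are involved they are distinct; the others are unchanged): Edge sign-change: $p\,\text{---}\,q$ becomes $p+\boldsymbol\varepsilon\,\text{---}\,q+\boldsymbol\varepsilon$.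 Slide: $p\,\text{---}\,q$ and $r\,\text{---}\,p+\mathbf a$ ($\mathbf a\in\mathbf A^+$) become $p\,\text{---}\,q$ and $r\,\text{---}\,q+\mathbf a$. Connection: $q\,\text{---}\,p+\mathbf w_1$ and $p\,\text{---}\,p+\mathbf w$ with $\mathbf w,\mathbf w_1,\mathbf w_2\in\mathbf A^+$, $\mathbf w_1+\mathbf w_2=k\mathbf w$, $k\in\mathbb N$, become $p\,\text{---}\,q+\mathbf w_2$ and $q\,\text{---}\,q+\mathbf w$. *)

theory Defs
  imports
    "HOL-Algebra.Group"
    "HOL-Library.Z2"
    "HOL-Library.Product_Plus"
    "HOL-Library.Function_Algebras"
    "HOL-Library.Multiset"
    "HOL-Computational_Algebra.Primes"
    "Graph_Theory.Bidirected_Digraph"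
    "Graph_Theory.Digraph_Component"
begin

section \<open>GBS graphs\<close>

text \<open>
  A graph in the sense of Serre is a digraph with an arc-reversing involution: \<open>\<iota> = tail\<close> and
  \<open>\<tau> = head\<close>. The locale \<open>bidirected_digraph\<close> says that the involution has no fixed points on the arcs
  (and, to make it a total function, that it is the identity off the arcs).
\<close>

record ('v, 'e) gbs =
  gr :: "('v, 'e) pre_digraph"
  bar :: "'e \<Rightarrow> 'e"
  psi :: "'e \<Rightarrow> int"

abbreviation Verts :: "('v, 'e) gbs \<Rightarrow> 'v set" where
  "Verts \<Gamma> \<equiv> verts (gr \<Gamma>)"

abbreviation Edges :: "('v, 'e) gbs \<Rightarrow> 'e set" where
  "Edges \<Gamma> \<equiv> arcs (gr \<Gamma>)"

definition gbs_graph :: "('v, 'e) gbs \<Rightarrow> bool" where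
  "gbs_graph \<Gamma> \<longleftrightarrow>
     fin_digraph (gr \<Gamma>) \<and> bidirected_digraph (gr \<Gamma>) (bar \<Gamma>) \<and>
     Digraph_Component.connected (gr \<Gamma>) \<and> (\<forall>e \<in> Edges \<Gamma>. psi \<Gamma> e \<noteq> 0)"


section \<open>The GBS group\<close>

text \<open>
  The fundamental group of the graph of groups, based at a vertex \<open>u\<close>, following Serre: the group
  \<open>F(\<Gamma>)\<close> is generated by the vertex groups and the edges, with relations
  \<open>bar e = e\<inverse>\<close> and \<open>e x\<^sup>e e\<inverse> = x\<^bsup>bar e\<^esup>\<close>, where \<open>x\<^sup>e\<close> is the image of \<open>x \<in> G\<^sub>e\<close> in
  \<open>G\<^bsub>\<tau> e\<^esub>\<close>; the fundamental group consists of the elements of \<open>F(\<Gamma>)\<close> represented by words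
  that run along closed paths at \<open>u\<close>. The letter \<open>Elt v n\<close> is the element \<open>n\<close> of \<open>G\<^sub>v = \<int>\<close>.
\<close>

datatype ('v, 'e) letter = Elt 'v int | Edge 'e

inductive word_eq ::
  "('v, 'e) gbs \<Rightarrow> ('v, 'e) letter list \<Rightarrow> ('v, 'e) letter list \<Rightarrow> bool" for \<Gamma> where
  refl: "word_eq \<Gamma> x x"
| sym: "word_eq \<Gamma> x y \<Longrightarrow> word_eq \<Gamma> y x"
| trans: "word_eq \<Gamma> x y \<Longrightarrow> word_eq \<Gamma> y z \<Longrightarrow> word_eq \<Gamma> x z"
| cong: "word_eq \<Gamma> x y \<Longrightarrow> word_eq \<Gamma> (l @ x @ r) (l @ y @ r)"
| vert_one: "v \<in> Verts \<Gamma> \<Longrightarrow> word_eq \<Gamma> [Elt v 0] []"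
| vert_mult: "v \<in> Verts \<Gamma> \<Longrightarrow> word_eq \<Gamma> [Elt v m, Elt v n] [Elt v (m + n)]"
| edge_inv: "e \<in> Edges \<Gamma> \<Longrightarrow> word_eq \<Gamma> [Edge e, Edge (bar \<Gamma> e)] []"
| edge_conj: "e \<in> Edges \<Gamma> \<Longrightarrow>
    word_eq \<Gamma> [Edge e, Elt (head (gr \<Gamma>) e) (psi \<Gamma> e * n), Edge (bar \<Gamma> e)]
              [Elt (tail (gr \<Gamma>) e) (psi \<Gamma> (bar \<Gamma> e) * n)]"

fun path_word :: "('v, 'e) gbs \<Rightarrow> 'v \<Rightarrow> ('v, 'e) letter list \<Rightarrow> 'v \<Rightarrow> bool" where
  "path_word \<Gamma> u [] v \<longleftrightarrow> u \<in> Verts \<Gamma> \<and> u = v"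
| "path_word \<Gamma> u (Elt x n # ws) v \<longleftrightarrow> u = x \<and> path_word \<Gamma> u ws v"
| "path_word \<Gamma> u (Edge e # ws) v \<longleftrightarrow>
     e \<in> Edges \<Gamma> \<and> u = tail (gr \<Gamma>) e \<and> path_word \<Gamma> (head (gr \<Gamma>) e) ws v"

definition word_class ::
  "('v, 'e) gbs \<Rightarrow> ('v, 'e) letter list \<Rightarrow> ('v, 'e) letter list set" where
  "word_class \<Gamma> x = {y. word_eq \<Gamma> x y}"

definition gbs_group :: "('v, 'e) gbs \<Rightarrow> 'v \<Rightarrow> ('v, 'e) letter list set monoid" where
  "gbs_group \<Gamma> u =
     \<lparr>carrier = {word_class \<Gamma> x | x. path_word \<Gamma> u x u},
      monoid.mult = (\<lambda>X Y. \<Union>x \<in> X. \<Union>y \<in> Y. word_class \<Gamma> (x @ y)),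
      one = word_class \<Gamma> []\<rparr>"

text \<open>
  Since GBS graphs are finite, those with vertices and edges in \<open>nat\<close> represent all of them. By
  connectedness the group does not depend on the base vertex up to isomorphism.
\<close>

definition totally_reduced :: "('v, 'e) gbs \<Rightarrow> bool" where
  "totally_reduced \<Gamma> \<longleftrightarrow>
     (\<forall>\<Delta> :: (nat, nat) gbs. gbs_graph \<Delta> \<longrightarrow>
        (\<exists>u \<in> Verts \<Gamma>. \<exists>v \<in> Verts \<Delta>. gbs_group \<Gamma> u \<cong> gbs_group \<Delta> v) \<longrightarrow>
        card (Verts \<Gamma>) \<le> card (Verts \<Delta>) \<and> card (Edges \<Gamma>) \<le> card (Edges \<Delta>))"


section \<open>The affine representation\<close>

text \<open>
  Elements \<open>(a\<^sub>0, (a\<^sub>r)\<^sub>r)\<close> of \<open>\<int>/2 \<oplus> (\<Oplus>\<^bsub>r \<in> \<P>\<^esub> \<int>)\<close> are pairs whose second component is a function on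
  \<open>nat\<close> vanishing off \<open>\<P>\<close>. In this way the vectors of different GBS graphs have the same type.
\<close>

type_synonym avec = "bit \<times> (nat \<Rightarrow> int)"

type_synonym 'v point = "'v \<times> avec"

definition prime_set :: "('v, 'e) gbs \<Rightarrow> nat set" where
  "prime_set \<Gamma> = {r. prime r \<and> (\<exists>e \<in> Edges \<Gamma>. int r dvd psi \<Gamma> e)}"

definition Apos :: "('v, 'e) gbs \<Rightarrow> avec set" where
  "Apos \<Gamma> = {a. (\<forall>r. 0 \<le> snd a r) \<and> (\<forall>r. r \<notin> prime_set \<Gamma> \<longrightarrow> snd a r = 0)}"

definition supp :: "avec \<Rightarrow> nat set" where
  "supp a = {r. snd a r \<noteq> 0}"

definition eps :: avec where
  "eps = (1, 0)"

definition avec_of_int :: "int \<Rightarrow> avec" where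
  "avec_of_int n =
     (if n < 0 then 1 else 0, \<lambda>r. if prime r then int (multiplicity (int r) n) else 0)"

lemma avec_of_int_psi:
  assumes "gbs_graph \<Gamma>" "e \<in> Edges \<Gamma>" and a: "a = avec_of_int (psi \<Gamma> e)"
  shows "a \<in> Apos \<Gamma>"
    and "psi \<Gamma> e = (if fst a = 1 then -1 else 1) * (\<Prod>r \<in> prime_set \<Gamma>. int r ^ nat (snd a r))"
proof -
  let ?n = "psi \<Gamma> e" and ?P = "prime_set \<Gamma>"
  have nz: "psi \<Gamma> f \<noteq> 0" if "f \<in> Edges \<Gamma>" for f
    using assms(1) that by (auto simp: gbs_graph_def)
  have "finite (Edges \<Gamma>)"
    using assms(1) by (auto simp: gbs_graph_def fin_digraph.finite_arcs)
  moreover have "int ` ?P \<subseteq> (\<Union>f \<in> Edges \<Gamma>. prime_factors (psi \<Gamma> f))"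
    using nz by (auto simp: prime_set_def in_prime_factors_iff)
  ultimately have "finite (int ` ?P)"
    by (meson finite_UN finite_set_mset finite_subset)
  then have fin: "finite ?P"
    by (rule finite_imageD) simp
  have mult0: "multiplicity (int r) ?n = 0" if "prime r" "r \<notin> ?P" for r
    using that assms(2) by (auto simp: prime_set_def intro: not_dvd_imp_multiplicity_0)
  then show "a \<in> Apos \<Gamma>"
    by (auto simp: Apos_def a avec_of_int_def)
  have sub: "prime_factors ?n \<subseteq> int ` ?P"
  proof
    fix q assume q: "q \<in> prime_factors ?n"
    then have "q = int (nat q)" "prime q" "q dvd ?n"
      by (auto simp: in_prime_factors_iff prime_ge_0_int)
    then have "nat q \<in> ?P"
      using assms(2) by (auto simp: prime_set_def)
    with \<open>q = int (nat q)\<close> show "q \<in> int ` ?P" by blast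
  qed
  have "\<bar>?n\<bar> = (\<Prod>q \<in> prime_factors ?n. q ^ multiplicity q ?n)"
    using prod_prime_factors[of ?n] nz[OF assms(2)] by simp
  also have "\<dots> = (\<Prod>q \<in> int ` ?P. q ^ multiplicity q ?n)"
    by (rule prod.mono_neutral_left)
      (use fin sub nz[OF assms(2)] in \<open>auto simp: prime_set_def in_prime_factors_iff not_dvd_imp_multiplicity_0\<close>)
  also have "\<dots> = (\<Prod>r \<in> ?P. int r ^ multiplicity (int r) ?n)"
    by (simp add: prod.reindex)
  also have "\<dots> = (\<Prod>r \<in> ?P. int r ^ nat (snd a r))"
    by (rule prod.cong) (auto simp: a avec_of_int_def prime_set_def)
  finally show "?n = (if fst a = 1 then -1 else 1) * (\<Prod>r \<in> ?P. int r ^ nat (snd a r))"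
    by (auto simp: a avec_of_int_def abs_if split: if_splits)
qed

definition points :: "('v, 'e) gbs \<Rightarrow> 'v point set" where
  "points \<Gamma> = Verts \<Gamma> \<times> Apos \<Gamma>"

definition tau :: "('v, 'e) gbs \<Rightarrow> 'e \<Rightarrow> 'v point" where
  "tau \<Gamma> e = (head (gr \<Gamma>) e, avec_of_int (psi \<Gamma> e))"

definition iota :: "('v, 'e) gbs \<Rightarrow> 'e \<Rightarrow> 'v point" where
  "iota \<Gamma> e = tau \<Gamma> (bar \<Gamma> e)"

definition shift :: "'v point \<Rightarrow> avec \<Rightarrow> 'v point" (infixl \<open>\<oplus>\<^sub>p\<close> 65) where
  "p \<oplus>\<^sub>p w = (fst p, snd p + w)"

definition point_le :: "('v, 'e) gbs \<Rightarrow> 'v point \<Rightarrow> 'v point \<Rightarrow> bool" where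
  "point_le \<Gamma> p p' \<longleftrightarrow> (\<exists>w \<in> Apos \<Gamma>. p' = p \<oplus>\<^sub>p w)"

fun affine_path :: "('v, 'e) gbs \<Rightarrow> 'v point \<Rightarrow> 'e list \<Rightarrow> 'v point \<Rightarrow> bool" where
  "affine_path \<Gamma> p [] p' \<longleftrightarrow> p = p'"
| "affine_path \<Gamma> p (e # es) p' \<longleftrightarrow>
     e \<in> Edges \<Gamma> \<and> (\<exists>w \<in> Apos \<Gamma>. p = iota \<Gamma> e \<oplus>\<^sub>p w \<and> affine_path \<Gamma> (tau \<Gamma> e \<oplus>\<^sub>p w) es p')"

definition conjugate :: "('v, 'e) gbs \<Rightarrow> 'v point \<Rightarrow> 'v point \<Rightarrow> bool" where
  "conjugate \<Gamma> p q \<longleftrightarrow> p \<in> points \<Gamma> \<and> q \<in> points \<Gamma> \<and> (\<exists>es. affine_path \<Gamma> p es q)"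

definition conj_le :: "('v, 'e) gbs \<Rightarrow> 'v point \<Rightarrow> 'v point \<Rightarrow> bool" where
  "conj_le \<Gamma> p q \<longleftrightarrow> p \<in> points \<Gamma> \<and> (\<exists>q'. conjugate \<Gamma> q' q \<and> point_le \<Gamma> p q')"

definition quasi_conj :: "('v, 'e) gbs \<Rightarrow> 'v point \<Rightarrow> 'v point \<Rightarrow> bool" where
  "quasi_conj \<Gamma> p q \<longleftrightarrow> conj_le \<Gamma> p q \<and> conj_le \<Gamma> q p"

definition qc_class :: "('v, 'e) gbs \<Rightarrow> 'v point set \<Rightarrow> bool" where
  "qc_class \<Gamma> Q \<longleftrightarrow> (\<exists>p \<in> points \<Gamma>. Q = {q. quasi_conj \<Gamma> q p})"

definition min_qc :: "('v, 'e) gbs \<Rightarrow> 'v point set \<Rightarrow> 'v point set" where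
  "min_qc \<Gamma> Q = {q \<in> Q. \<forall>q' \<in> Q. point_le \<Gamma> q' q \<longrightarrow> point_le \<Gamma> q q'}"

text \<open>The inner union below is the same for all \<open>p \<in> Q\<close> when \<open>Q\<close> is a quasi-conjugacy class.\<close>

definition supp_qc :: "('v, 'e) gbs \<Rightarrow> 'v point set \<Rightarrow> nat set" where
  "supp_qc \<Gamma> Q = (\<Union>p \<in> Q. \<Union>{supp u | u. u \<in> Apos \<Gamma> \<and> quasi_conj \<Gamma> (p \<oplus>\<^sub>p u) p})"

definition one_qc_class :: "('v, 'e) gbs \<Rightarrow> 'v point set \<Rightarrow> bool" where
  "one_qc_class \<Gamma> Q \<longleftrightarrow> qc_class \<Gamma> Q \<and> (\<forall>e \<in> Edges \<Gamma>. iota \<Gamma> e \<in> Q \<and> tau \<Gamma> e \<in> Q)"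


section \<open>Clean GBS graphs and rigid cycles\<close>

text \<open>
  Minimal points \<open>m\<close> and \<open>m + \<epsilon>\<close> count as one point; \<open>at_point m\<close> is the set of actual points involved.
\<close>

definition at_point :: "'v point \<Rightarrow> 'v point set" where
  "at_point m = {m, m \<oplus>\<^sub>p eps}"

text \<open>
  An unoriented edge with a choice of one of its two endpoints is an oriented edge \<open>e\<close>, the chosen
  endpoint being \<open>iota \<Gamma> e\<close>.
\<close>

definition clean :: "('v, 'e) gbs \<Rightarrow> 'v point set \<Rightarrow> bool" where
  "clean \<Gamma> Q \<longleftrightarrow>
     (\<forall>m \<in> min_qc \<Gamma> Q. \<exists>!e. e \<in> Edges \<Gamma> \<and> iota \<Gamma> e \<in> at_point m) \<and>
     \<not> (\<exists>e \<in> Edges \<Gamma>. iota \<Gamma> e \<in> min_qc \<Gamma> Q \<and> tau \<Gamma> e \<in> min_qc \<Gamma> Q)"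

definition floating_pieces :: "('v, 'e) gbs \<Rightarrow> 'v point set \<Rightarrow> bool" where
  "floating_pieces \<Gamma> Q \<longleftrightarrow> card (at_point ` min_qc \<Gamma> Q) < card ((\<lambda>e. {e, bar \<Gamma> e}) ` Edges \<Gamma>)"

definition rigid_cycle ::
  "('v, 'e) gbs \<Rightarrow> 'v point set \<Rightarrow> 'e list \<Rightarrow> avec list \<Rightarrow> bool" where
  "rigid_cycle \<Gamma> Q es ws \<longleftrightarrow>
     es \<noteq> [] \<and> length ws = length es \<and> set es \<subseteq> Edges \<Gamma> \<and> set ws \<subseteq> Apos \<Gamma> \<and>
     (\<forall>i < length es. iota \<Gamma> (es ! i) \<in> min_qc \<Gamma> Q) \<and>
     (\<forall>i < length es. \<forall>j < length es. i \<noteq> j \<longrightarrow> iota \<Gamma> (es ! j) \<notin> at_point (iota \<Gamma> (es ! i))) \<and>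
     (\<forall>i < length es.
        tau \<Gamma> (es ! i) = iota \<Gamma> (es ! (Suc i mod length es)) \<oplus>\<^sub>p ws ! i) \<and>
     \<not> (\<exists>m \<in> min_qc \<Gamma> Q. \<exists>m' \<in> min_qc \<Gamma> Q.
          m' \<notin> at_point m \<and> point_le \<Gamma> m' (m \<oplus>\<^sub>p sum_list ws))"

definition rotations :: "'a list \<Rightarrow> 'a list set" where
  "rotations xs = range (\<lambda>n. rotate n xs)"

text \<open>
  The vectors \<open>ws\<close> are determined by the edges \<open>es\<close>, and rotating \<open>es\<close> does not change their sum; so
  the set below has exactly one element for each rigid cycle up to rotation. It is finite, because
  the edges of a rigid cycle are pairwise distinct.
\<close>

definition rigid_vectors :: "('v, 'e) gbs \<Rightarrow> 'v point set \<Rightarrow> avec multiset" where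
  "rigid_vectors \<Gamma> Q =
     image_mset snd (mset_set {(rotations es, sum_list ws) | es ws. rigid_cycle \<Gamma> Q es ws})"


section \<open>Moves\<close>

definition edge_between :: "('v, 'e) gbs \<Rightarrow> 'e \<Rightarrow> 'v point \<Rightarrow> 'v point \<Rightarrow> bool" where
  "edge_between \<Gamma> e p q \<longleftrightarrow> e \<in> Edges \<Gamma> \<and> iota \<Gamma> e = p \<and> tau \<Gamma> e = q"

definition unchanged_except :: "'e set \<Rightarrow> ('v, 'e) gbs \<Rightarrow> ('v, 'e) gbs \<Rightarrow> bool" where
  "unchanged_except D \<Gamma> \<Gamma>' \<longleftrightarrow>
     Verts \<Gamma>' = Verts \<Gamma> \<and> Edges \<Gamma>' = Edges \<Gamma> \<and> (\<forall>e \<in> Edges \<Gamma>. bar \<Gamma>' e = bar \<Gamma> e) \<and>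
     (\<forall>e \<in> Edges \<Gamma>. e \<notin> D \<and> bar \<Gamma> e \<notin> D \<longrightarrow> iota \<Gamma>' e = iota \<Gamma> e \<and> tau \<Gamma>' e = tau \<Gamma> e)"

definition edge_sign_change :: "('v, 'e) gbs \<Rightarrow> ('v, 'e) gbs \<Rightarrow> bool" where
  "edge_sign_change \<Gamma> \<Gamma>' \<longleftrightarrow>
     (\<exists>e p q. edge_between \<Gamma> e p q \<and> edge_between \<Gamma>' e (p \<oplus>\<^sub>p eps) (q \<oplus>\<^sub>p eps) \<and>
        unchanged_except {e} \<Gamma> \<Gamma>')"

definition slide :: "('v, 'e) gbs \<Rightarrow> ('v, 'e) gbs \<Rightarrow> bool" where
  "slide \<Gamma> \<Gamma>' \<longleftrightarrow>
     (\<exists>e d p q r a. a \<in> Apos \<Gamma> \<and> d \<notin> {e, bar \<Gamma> e} \<and>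
        edge_between \<Gamma> e p q \<and> edge_between \<Gamma> d r (p \<oplus>\<^sub>p a) \<and>
        edge_between \<Gamma>' e p q \<and> edge_between \<Gamma>' d r (q \<oplus>\<^sub>p a) \<and>
        unchanged_except {e, d} \<Gamma> \<Gamma>')"

definition connection :: "('v, 'e) gbs \<Rightarrow> ('v, 'e) gbs \<Rightarrow> bool" where
  "connection \<Gamma> \<Gamma>' \<longleftrightarrow>
     (\<exists>d e p q w w\<^sub>1 w\<^sub>2. \<exists>k :: nat.
        w \<in> Apos \<Gamma> \<and> w\<^sub>1 \<in> Apos \<Gamma> \<and> w\<^sub>2 \<in> Apos \<Gamma> \<and> w\<^sub>1 + w\<^sub>2 = (\<Sum>i<k. w) \<and>
        d \<notin> {e, bar \<Gamma> e} \<and>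
        edge_between \<Gamma> d q (p \<oplus>\<^sub>p w\<^sub>1) \<and> edge_between \<Gamma> e p (p \<oplus>\<^sub>p w) \<and>
        edge_between \<Gamma>' d p (q \<oplus>\<^sub>p w\<^sub>2) \<and> edge_between \<Gamma>' e q (q \<oplus>\<^sub>p w) \<and>
        unchanged_except {d, e} \<Gamma> \<Gamma>')"

end

theory Submission
  imports Defs
begin

text \<open>
  The point is that a rigid cycle is determined by its set of edges, and its vector is a sum over
  that set. In a clean graph without floating pieces there are as many edges as minimal points, so
  every edge has exactly one minimal endpoint; orient it so as to start there
  (\<open>outgoing_or_bar_outgoing\<close>). Say that \<open>e\<close> leads to \<open>f\<close> if the head of \<open>e\<close> lies above the tail of \<open>f\<close>.
  A rigid cycle is a cycle for this relation, and its rigid vector telescopes to the sum of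
  \<open>tau e - iota e\<close> over its edges (\<open>total_rise\<close>). Each single gap of the cycle is at most the rigid
  vector; so by the last condition on rigid cycles the head of each edge lies above one
  minimal point only, and each edge of a rigid cycle leads to one edge only (\<open>rigid_list_next\<close>).
  Consequently the edge set determines the cycle up to rotation, and the multiset of rigid vectors
  is the image under \<open>total_rise\<close> of the family of edge sets of rigid cycles
  (\<open>rigid_vectors_eq_total_rises\<close>).

  Moves are reversible and they replace the endpoints of edges by conjugate ones; hence conjugacy,
  the quasi-conjugacy class and its minimal points are the same before and after a move
  (\<open>move_quasi_conj_eq\<close>, \<open>move_qc_class_eq\<close>, \<open>move_min_qc_eq\<close>). It remains to compare edge sets.

  \<^item> A sign change moves both endpoints of an edge by \<open>eps\<close>. Neither the relation nor the total
    rises see this.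
  \<^item> In a slide of \<open>d\<close> over an edge \<open>e\<close> that starts at a minimal point, a rigid cycle through \<open>d\<close>
    continues with \<open>e\<close> before the slide and skips \<open>e\<close> afterwards. Removing \<open>e\<close> from the sets that
    contain \<open>d\<close> is a bijection, and the total rise is unchanged because \<open>d\<close> absorbs the rise of
    \<open>e\<close> (\<open>slide_at_minimum\<close>). If \<open>e\<close> ends at a minimal point, the inverse slide is of this kind.
  \<^item> In a connection, \<open>e\<close> leads to itself and \<open>d\<close> leads to \<open>e\<close>, so \<open>d\<close> is in no rigid cycle
    and \<open>e\<close> can only form a cycle of length one. Its vector \<open>w\<close> is the same on both sides
    (\<open>connection_rigid_sets\<close>).
\<close>

text \<open>
  Points are nested pairs; without the following, the simplifier splits every quantifier over
  points into three.
\<close>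

declare split_paired_Ex [simp del] split_paired_All [simp del]

section \<open>Translation, order and conjugacy of points\<close>

lemma zero_in_Apos: "0 \<in> Apos \<Gamma>"
  by (simp add: Apos_def)

lemma eps_in_Apos: "eps \<in> Apos \<Gamma>"
  by (simp add: Apos_def eps_def)

lemma add_in_Apos: "a \<in> Apos \<Gamma> \<Longrightarrow> b \<in> Apos \<Gamma> \<Longrightarrow> a + b \<in> Apos \<Gamma>"
  by (simp add: Apos_def)

lemma sum_in_Apos: "(\<And>i. i \<in> I \<Longrightarrow> f i \<in> Apos \<Gamma>) \<Longrightarrow> sum f I \<in> Apos \<Gamma>"
  by (induction I rule: infinite_finite_induct) (auto intro: zero_in_Apos add_in_Apos)

lemma eps_add_eps: "eps + eps = 0"
  by (simp add: eps_def prod_eq_iff)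

text \<open>
  Non-negative coordinates cannot cancel. The summands may come from the cones of other graphs: in
  this way membership in the cone passes from the endpoints of one graph to the vectors of a move.
\<close>

lemma Apos_summands:
  assumes "a + b \<in> Apos \<Gamma>" "a \<in> Apos \<Gamma>\<^sub>1" "b \<in> Apos \<Gamma>\<^sub>2"
  shows "a \<in> Apos \<Gamma>" "b \<in> Apos \<Gamma>"
proof -
  have "snd a r = 0 \<and> snd b r = 0" if "r \<notin> prime_set \<Gamma>" for r
  proof -
    have "snd a r + snd b r = 0" "0 \<le> snd a r" "0 \<le> snd b r"
      using assms that by (auto simp: Apos_def)
    then show ?thesis by linarith
  qed
  then show "a \<in> Apos \<Gamma>" "b \<in> Apos \<Gamma>"
    using assms(2,3) unfolding Apos_def by blast+
qed

lemma shift_zero [simp]: "p \<oplus>\<^sub>p 0 = p"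
  by (simp add: shift_def)

lemma shift_shift: "p \<oplus>\<^sub>p a \<oplus>\<^sub>p b = p \<oplus>\<^sub>p (a + b)"
  by (simp add: shift_def add.assoc)

lemma snd_shift [simp]: "snd (p \<oplus>\<^sub>p a) = snd p + a"
  by (simp add: shift_def)

lemma shift_eps_eps [simp]: "p \<oplus>\<^sub>p eps \<oplus>\<^sub>p eps = p"
  by (simp add: shift_shift eps_add_eps)

lemma point_le_shift: "w \<in> Apos \<Gamma> \<Longrightarrow> point_le \<Gamma> p (p \<oplus>\<^sub>p w)"
  by (auto simp: point_le_def)

lemma point_le_refl: "point_le \<Gamma> p p"
  using point_le_shift[OF zero_in_Apos] by simp

lemma point_le_trans: "point_le \<Gamma> p q \<Longrightarrow> point_le \<Gamma> q r \<Longrightarrow> point_le \<Gamma> p r"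
  unfolding point_le_def using add_in_Apos shift_shift by blast

lemma point_le_iff:
  "point_le \<Gamma> p q \<longleftrightarrow> fst p = fst q \<and> snd q - snd p \<in> Apos \<Gamma>"
proof
  assume "fst p = fst q \<and> snd q - snd p \<in> Apos \<Gamma>"
  moreover from this have "q = p \<oplus>\<^sub>p (snd q - snd p)"
    by (simp add: shift_def)
  ultimately show "point_le \<Gamma> p q"
    unfolding point_le_def by blast
qed (auto simp: point_le_def shift_def)

text \<open>
  The order is only a preorder: the units of the monoid \<open>Apos \<Gamma>\<close> are \<open>0\<close> and \<open>eps\<close>, so that
  equivalence for the preorder is the identification made by \<open>at_point\<close>.
\<close>

lemma at_point_iff_point_le: "q \<in> at_point p \<longleftrightarrow> point_le \<Gamma> p q \<and> point_le \<Gamma> q p"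
proof
  assume "q \<in> at_point p"
  then consider "q = p" | "q = p \<oplus>\<^sub>p eps"
    by (auto simp: at_point_def)
  then show "point_le \<Gamma> p q \<and> point_le \<Gamma> q p"
  proof cases
    case 1
    then show ?thesis by (simp add: point_le_refl)
  next
    case 2
    then show ?thesis
      using point_le_shift[OF eps_in_Apos, of \<Gamma> p]
        point_le_shift[OF eps_in_Apos, of \<Gamma> "p \<oplus>\<^sub>p eps"] by simp
  qed
next
  assume le: "point_le \<Gamma> p q \<and> point_le \<Gamma> q p"
  then obtain a b where ab: "a \<in> Apos \<Gamma>" "b \<in> Apos \<Gamma>" "q = p \<oplus>\<^sub>p a" "p = q \<oplus>\<^sub>p b"
    by (auto simp: point_le_def)
  have "p \<oplus>\<^sub>p (a + b) = p"
    by (simp only: shift_shift[symmetric] ab(3)[symmetric] ab(4)[symmetric])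
  then have "snd p = snd p + (a + b)"
    using snd_shift[of p "a + b"] by simp
  then have "a + b = 0"
    by (simp only: add_cancel_right_right)
  then have "snd (a + b) r = 0" for r
    by simp
  then have "snd a r + snd b r = 0" for r
    by simp
  moreover have "0 \<le> snd a r" "0 \<le> snd b r" for r
    using ab(1,2) by (auto simp: Apos_def)
  ultimately have "snd a = 0"
    by (simp add: fun_eq_iff add_nonneg_eq_0_iff)
  then have "a = 0 \<or> a = eps"
    by (cases "fst a") (auto simp: eps_def prod_eq_iff)
  then show "q \<in> at_point p"
    using ab(3) by (auto simp: at_point_def)
qed

lemma at_point_self: "p \<in> at_point p"
  by (simp add: at_point_def)

lemma at_point_eq_iff: "at_point p = at_point q \<longleftrightarrow> q \<in> at_point p"
  by (auto simp: at_point_def)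

lemma bidirected_of_gbs: "gbs_graph \<Gamma> \<Longrightarrow> bidirected_digraph (gr \<Gamma>) (bar \<Gamma>)"
  by (simp add: gbs_graph_def)

lemma bar_bar [simp]: "gbs_graph \<Gamma> \<Longrightarrow> bar \<Gamma> (bar \<Gamma> e) = e"
  by (rule bidirected_digraph.arev_arev[OF bidirected_of_gbs])

lemma bar_in_Edges [simp]: "gbs_graph \<Gamma> \<Longrightarrow> e \<in> Edges \<Gamma> \<Longrightarrow> bar \<Gamma> e \<in> Edges \<Gamma>"
  by (simp add: bidirected_digraph.arev_in_arcs bidirected_of_gbs)

lemma tau_bar: "tau \<Gamma> (bar \<Gamma> e) = iota \<Gamma> e"
  by (simp add: iota_def)

lemma iota_bar [simp]: "gbs_graph \<Gamma> \<Longrightarrow> iota \<Gamma> (bar \<Gamma> e) = tau \<Gamma> e"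
  by (simp add: iota_def)

lemma finite_Edges: "gbs_graph \<Gamma> \<Longrightarrow> finite (Edges \<Gamma>)"
  by (simp add: gbs_graph_def fin_digraph.finite_arcs)

lemma tau_in_points: "gbs_graph \<Gamma> \<Longrightarrow> e \<in> Edges \<Gamma> \<Longrightarrow> tau \<Gamma> e \<in> points \<Gamma>"
  using avec_of_int_psi(1)[OF _ _ HOL.refl, of \<Gamma> e]
  by (simp add: tau_def points_def gbs_graph_def fin_digraph_def wf_digraph.head_in_verts)

lemma iota_in_points: "gbs_graph \<Gamma> \<Longrightarrow> e \<in> Edges \<Gamma> \<Longrightarrow> iota \<Gamma> e \<in> points \<Gamma>"
  by (simp add: iota_def tau_in_points)

lemma shift_in_points: "p \<in> points \<Gamma> \<Longrightarrow> w \<in> Apos \<Gamma> \<Longrightarrow> p \<oplus>\<^sub>p w \<in> points \<Gamma>"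
  by (auto simp: points_def shift_def intro: add_in_Apos)

lemma snd_points: "p \<in> points \<Gamma> \<Longrightarrow> snd p \<in> Apos \<Gamma>"
  by (auto simp: points_def)

lemma prime_set_eq_supports:
  assumes "gbs_graph \<Gamma>"
  shows "prime_set \<Gamma> = (\<Union>e \<in> Edges \<Gamma>. supp (snd (tau \<Gamma> e)))"
proof -
  have "r \<in> supp (snd (tau \<Gamma> e)) \<longleftrightarrow> prime r \<and> int r dvd psi \<Gamma> e" if "e \<in> Edges \<Gamma>" for r e
  proof -
    have "psi \<Gamma> e \<noteq> 0"
      using assms that by (auto simp: gbs_graph_def)
    then have "multiplicity (int r) (psi \<Gamma> e) \<noteq> 0 \<longleftrightarrow> int r dvd psi \<Gamma> e" if "prime r"
      using prime_multiplicity_gt_zero_iff[of "int r" "psi \<Gamma> e"] that by simp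
    then show ?thesis
      by (simp add: supp_def tau_def avec_of_int_def)
  qed
  then show ?thesis
    by (auto simp: prime_set_def)
qed

lemma finite_prime_set:
  assumes "gbs_graph \<Gamma>"
  shows "finite (prime_set \<Gamma>)"
proof -
  have nz: "psi \<Gamma> f \<noteq> 0" if "f \<in> Edges \<Gamma>" for f
    using assms that by (simp add: gbs_graph_def)
  have "int ` prime_set \<Gamma> \<subseteq> (\<Union>f \<in> Edges \<Gamma>. prime_factors (psi \<Gamma> f))"
    using nz by (auto simp: prime_set_def in_prime_factors_iff)
  then have "finite (int ` prime_set \<Gamma>)"
    by (rule finite_subset) (simp add: finite_Edges assms)
  then show ?thesis
    by (rule finite_imageD) simp
qed

lemma conjugate_refl: "p \<in> points \<Gamma> \<Longrightarrow> conjugate \<Gamma> p p"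
  by (auto simp: conjugate_def intro: exI[of _ "[]"])

lemma affine_path_append:
  "affine_path \<Gamma> p es q \<Longrightarrow> affine_path \<Gamma> q fs r \<Longrightarrow> affine_path \<Gamma> p (es @ fs) r"
  by (induction es arbitrary: p) (simp, simp, blast)

lemma affine_path_shift:
  "affine_path \<Gamma> p es q \<Longrightarrow> w \<in> Apos \<Gamma> \<Longrightarrow> affine_path \<Gamma> (p \<oplus>\<^sub>p w) es (q \<oplus>\<^sub>p w)"
proof (induction es arbitrary: p)
  case (Cons e es)
  then obtain u where u: "e \<in> Edges \<Gamma>" "u \<in> Apos \<Gamma>" "p = iota \<Gamma> e \<oplus>\<^sub>p u"
    "affine_path \<Gamma> (tau \<Gamma> e \<oplus>\<^sub>p u) es q" by auto
  have "affine_path \<Gamma> (tau \<Gamma> e \<oplus>\<^sub>p (u + w)) es (q \<oplus>\<^sub>p w)"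
    using Cons.IH[OF u(4) Cons.prems(2)] by (simp add: shift_shift)
  then show ?case
    using u Cons.prems(2) add_in_Apos[of u \<Gamma> w] by (auto simp: shift_shift)
qed auto

lemma conjugate_trans: "conjugate \<Gamma> p q \<Longrightarrow> conjugate \<Gamma> q r \<Longrightarrow> conjugate \<Gamma> p r"
  unfolding conjugate_def by (blast intro: affine_path_append)

lemma conjugate_shift: "conjugate \<Gamma> p q \<Longrightarrow> w \<in> Apos \<Gamma> \<Longrightarrow> conjugate \<Gamma> (p \<oplus>\<^sub>p w) (q \<oplus>\<^sub>p w)"
  unfolding conjugate_def by (blast intro: affine_path_shift shift_in_points)

lemma conjugate_edge:
  "gbs_graph \<Gamma> \<Longrightarrow> e \<in> Edges \<Gamma> \<Longrightarrow> conjugate \<Gamma> (iota \<Gamma> e) (tau \<Gamma> e)"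
  unfolding conjugate_def
  by (auto simp: tau_in_points iota_in_points zero_in_Apos intro!: exI[of _ "[e]"] bexI[of _ 0])

text \<open>
  Conjugacy is the least translation-invariant equivalence relation that relates the endpoints of
  every edge. To compare the conjugacy relations of two graphs it is therefore enough to look at the
  edges.
\<close>

lemma conjugate_if_edges_conjugate:
  assumes "Verts \<Gamma>' = Verts \<Gamma>" "Apos \<Gamma>' = Apos \<Gamma>"
    and edges: "\<And>e. e \<in> Edges \<Gamma>' \<Longrightarrow> conjugate \<Gamma> (iota \<Gamma>' e) (tau \<Gamma>' e)"
    and "conjugate \<Gamma>' p q"
  shows "conjugate \<Gamma> p q"
proof -
  have pts: "points \<Gamma>' = points \<Gamma>"
    using assms by (simp add: points_def)
  obtain es where es: "affine_path \<Gamma>' p es q" and "p \<in> points \<Gamma>"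
    using assms pts by (auto simp: conjugate_def)
  then show ?thesis
  proof (induction es arbitrary: p)
    case Nil
    then show ?case by (simp add: conjugate_refl)
  next
    case (Cons e es)
    then obtain w where w: "e \<in> Edges \<Gamma>'" "w \<in> Apos \<Gamma>" "p = iota \<Gamma>' e \<oplus>\<^sub>p w"
      "affine_path \<Gamma>' (tau \<Gamma>' e \<oplus>\<^sub>p w) es q"
      using assms by auto
    then have step: "conjugate \<Gamma> p (tau \<Gamma>' e \<oplus>\<^sub>p w)"
      unfolding w(3) by (blast intro: conjugate_shift edges)
    then have "tau \<Gamma>' e \<oplus>\<^sub>p w \<in> points \<Gamma>"
      by (simp add: conjugate_def)
    then show ?case
      using Cons.IH[OF w(4)] by (blast intro: conjugate_trans[OF step])
  qed
qed

lemma conjugate_sym: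
  assumes "gbs_graph \<Gamma>" "conjugate \<Gamma> p q"
  shows "conjugate \<Gamma> q p"
proof -
  obtain es where "affine_path \<Gamma> p es q" "p \<in> points \<Gamma>"
    using assms by (auto simp: conjugate_def)
  then show ?thesis
  proof (induction es arbitrary: p)
    case Nil
    then show ?case by (simp add: conjugate_refl)
  next
    case (Cons e es)
    then obtain w where w: "e \<in> Edges \<Gamma>" "w \<in> Apos \<Gamma>" "p = iota \<Gamma> e \<oplus>\<^sub>p w"
      "affine_path \<Gamma> (tau \<Gamma> e \<oplus>\<^sub>p w) es q"
      by auto
    have "conjugate \<Gamma> (tau \<Gamma> e \<oplus>\<^sub>p w) p"
      using conjugate_shift[OF conjugate_edge[of \<Gamma> "bar \<Gamma> e"]] assms w
      by (simp add: tau_bar)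
    moreover have "conjugate \<Gamma> q (tau \<Gamma> e \<oplus>\<^sub>p w)"
      using Cons.IH[OF w(4)] assms w by (simp add: tau_in_points shift_in_points)
    ultimately show ?case
      by (rule conjugate_trans[rotated])
  qed
qed

lemma conj_le_trans:
  assumes "conj_le \<Gamma> p q" "conj_le \<Gamma> q r"
  shows "conj_le \<Gamma> p r"
proof -
  obtain q' where q': "conjugate \<Gamma> q' q" "point_le \<Gamma> p q'"
    using assms by (auto simp: conj_le_def)
  obtain u where r': "conjugate \<Gamma> (q \<oplus>\<^sub>p u) r" "u \<in> Apos \<Gamma>"
    using assms by (auto simp: conj_le_def point_le_def)
  have "conjugate \<Gamma> (q' \<oplus>\<^sub>p u) r"
    by (rule conjugate_trans[OF conjugate_shift[OF q'(1) r'(2)] r'(1)])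
  moreover have "point_le \<Gamma> p (q' \<oplus>\<^sub>p u)"
    by (rule point_le_trans[OF q'(2) point_le_shift[OF r'(2)]])
  ultimately show ?thesis
    using assms(1) unfolding conj_le_def by blast
qed

lemma quasi_conj_sym: "quasi_conj \<Gamma> p q \<Longrightarrow> quasi_conj \<Gamma> q p"
  by (simp add: quasi_conj_def)

lemma quasi_conj_trans: "quasi_conj \<Gamma> p q \<Longrightarrow> quasi_conj \<Gamma> q r \<Longrightarrow> quasi_conj \<Gamma> p r"
  unfolding quasi_conj_def using conj_le_trans[of \<Gamma> p q r] conj_le_trans[of \<Gamma> r q p] by simp

lemma quasi_conj_if_point_le:
  assumes "p \<in> points \<Gamma>" "q \<in> points \<Gamma>" "point_le \<Gamma> p q" "point_le \<Gamma> q p"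
  shows "quasi_conj \<Gamma> p q"
  using assms conjugate_refl unfolding quasi_conj_def conj_le_def by blast

lemma qc_class_subset_points: "qc_class \<Gamma> Q \<Longrightarrow> Q \<subseteq> points \<Gamma>"
  by (auto simp: qc_class_def quasi_conj_def conj_le_def)

lemma qc_class_eqI:
  assumes "qc_class \<Gamma> Q" "qc_class \<Gamma>' Q'" "quasi_conj \<Gamma>' = quasi_conj \<Gamma>" "p \<in> Q" "p \<in> Q'"
  shows "Q' = Q"
proof -
  obtain u v where uv: "Q = {q. quasi_conj \<Gamma> q u}" "Q' = {q. quasi_conj \<Gamma> q v}"
    using assms(1-3) by (auto simp: qc_class_def)
  then have pu: "quasi_conj \<Gamma> p u" and pv: "quasi_conj \<Gamma> p v"
    using assms(4,5) by simp_all
  have uv': "quasi_conj \<Gamma> u v" and vu: "quasi_conj \<Gamma> v u"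
    using quasi_conj_trans[OF quasi_conj_sym[OF pu] pv] quasi_conj_sym by simp_all
  show ?thesis
    using uv quasi_conj_trans[OF _ uv'] quasi_conj_trans[OF _ vu] by blast
qed

lemma qc_class_at_point:
  assumes "qc_class \<Gamma> Q" "p \<in> Q" "q \<in> at_point p"
  shows "q \<in> Q"
proof -
  have "p \<in> points \<Gamma>"
    using qc_class_subset_points[OF assms(1)] assms(2) by blast
  moreover from this have "q \<in> points \<Gamma>"
    using assms(3) by (auto simp: at_point_def shift_in_points eps_in_Apos)
  ultimately have "quasi_conj \<Gamma> q p"
    using assms(3) at_point_iff_point_le[of q p \<Gamma>] by (auto intro: quasi_conj_if_point_le)
  moreover obtain p\<^sub>0 where "Q = {q. quasi_conj \<Gamma> q p\<^sub>0}"
    using assms(1) unfolding qc_class_def by blast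
  ultimately show ?thesis
    using assms(2) quasi_conj_trans[of \<Gamma> q p p\<^sub>0] by blast
qed

lemma min_qcD:
  assumes "x \<in> min_qc \<Gamma> Q"
  shows "x \<in> Q" "\<And>y. y \<in> Q \<Longrightarrow> point_le \<Gamma> y x \<Longrightarrow> point_le \<Gamma> x y"
  using assms unfolding min_qc_def by blast+

lemma min_qc_downward:
  assumes "x \<in> min_qc \<Gamma> Q" "y \<in> Q" "point_le \<Gamma> y x"
  shows "y \<in> min_qc \<Gamma> Q" "x \<in> at_point y"
proof -
  have "point_le \<Gamma> x y"
    by (rule min_qcD(2)[OF assms])
  then show "x \<in> at_point y"
    using assms(3) at_point_iff_point_le[of x y \<Gamma>] by simp
  have "point_le \<Gamma> y z" if "z \<in> Q" "point_le \<Gamma> z y" for z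
  proof -
    have "point_le \<Gamma> x z"
      by (rule min_qcD(2)[OF assms(1) that(1) point_le_trans[OF that(2) assms(3)]])
    then show ?thesis
      by (rule point_le_trans[OF assms(3)])
  qed
  then show "y \<in> min_qc \<Gamma> Q"
    using assms(2) unfolding min_qc_def by blast
qed

lemma min_qc_at_point:
  assumes "qc_class \<Gamma> Q" "p \<in> min_qc \<Gamma> Q" "q \<in> at_point p"
  shows "q \<in> min_qc \<Gamma> Q"
proof (rule min_qc_downward(1))
  show "q \<in> Q"
    by (rule qc_class_at_point[OF assms(1) min_qcD(1)[OF assms(2)] assms(3)])
  show "point_le \<Gamma> q p"
    using assms(3) at_point_iff_point_le[of q p \<Gamma>] by simp
qed (rule assms)

text \<open>
  Descent: a strict inequality lowers the total exponent over the finite set of primes.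
\<close>

lemma exists_min_qc_below:
  assumes "gbs_graph \<Gamma>" "qc_class \<Gamma> Q" "x \<in> Q"
  shows "\<exists>m \<in> min_qc \<Gamma> Q. point_le \<Gamma> m x"
  using assms(3)
proof (induction "nat (\<Sum>r \<in> prime_set \<Gamma>. snd (snd x) r)" arbitrary: x rule: less_induct)
  case less
  show ?case
  proof (cases "x \<in> min_qc \<Gamma> Q")
    case True
    then show ?thesis using point_le_refl by blast
  next
    case False
    then obtain y where y: "y \<in> Q" "point_le \<Gamma> y x" "\<not> point_le \<Gamma> x y"
      using less.prems by (auto simp: min_qc_def)
    then obtain w where w: "w \<in> Apos \<Gamma>" "x = y \<oplus>\<^sub>p w"
      by (auto simp: point_le_def)
    have "\<exists>r. snd w r \<noteq> 0"
    proof (rule ccontr)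
      assume "\<nexists>r. snd w r \<noteq> 0"
      then have "w = 0 \<or> w = eps"
        by (cases "fst w") (auto simp: eps_def prod_eq_iff fun_eq_iff)
      then have "x \<in> at_point y"
        using w by (auto simp: at_point_def)
      then show False
        using y(3) at_point_iff_point_le[of x y \<Gamma>] by simp
    qed
    then obtain r where "snd w r \<noteq> 0" ..
    then have r: "r \<in> prime_set \<Gamma>" "0 < snd w r"
      using w(1) by (auto simp: Apos_def order_less_le)
    have "0 < (\<Sum>r \<in> prime_set \<Gamma>. snd w r)"
      using r w(1) finite_prime_set[OF assms(1)] by (intro sum_pos2[of _ r]) (auto simp: Apos_def)
    moreover have "0 \<le> (\<Sum>r \<in> prime_set \<Gamma>. snd (snd y) r)"
      using y(1) qc_class_subset_points[OF assms(2)] snd_points[of y \<Gamma>]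
      by (intro sum_nonneg) (auto simp: Apos_def)
    ultimately have "nat (\<Sum>r \<in> prime_set \<Gamma>. snd (snd y) r)
        < nat (\<Sum>r \<in> prime_set \<Gamma>. snd (snd x) r)"
      by (simp add: w(2) sum.distrib)
    then show ?thesis
      using less.hyps y point_le_trans by blast
  qed
qed


section \<open>Clean graphs without floating pieces\<close>

definition outgoing :: "('v, 'e) gbs \<Rightarrow> 'v point set \<Rightarrow> 'e set" where
  "outgoing \<Gamma> Q = {e \<in> Edges \<Gamma>. iota \<Gamma> e \<in> min_qc \<Gamma> Q}"

definition leads_to :: "('v, 'e) gbs \<Rightarrow> 'e \<Rightarrow> 'e \<Rightarrow> bool" where
  "leads_to \<Gamma> e f \<longleftrightarrow> point_le \<Gamma> (iota \<Gamma> f) (tau \<Gamma> e)"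

definition total_rise :: "('v, 'e) gbs \<Rightarrow> 'e set \<Rightarrow> avec" where
  "total_rise \<Gamma> C = (\<Sum>e \<in> C. snd (tau \<Gamma> e) - snd (iota \<Gamma> e))"

definition isolating :: "('v, 'e) gbs \<Rightarrow> 'v point set \<Rightarrow> avec \<Rightarrow> bool" where
  "isolating \<Gamma> Q w \<longleftrightarrow>
     \<not> (\<exists>m \<in> min_qc \<Gamma> Q. \<exists>m' \<in> min_qc \<Gamma> Q. m' \<notin> at_point m \<and> point_le \<Gamma> m' (m \<oplus>\<^sub>p w))"

text \<open>
  These are the edge sequences of rigid cycles, without the vectors: those are determined by the
  edges. Pairing \<open>es\<close> with \<open>rotate1 es\<close> pairs each edge with its cyclic successor.
\<close>

definition rigid_list :: "('v, 'e) gbs \<Rightarrow> 'v point set \<Rightarrow> 'e list \<Rightarrow> bool" where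
  "rigid_list \<Gamma> Q es \<longleftrightarrow>
     es \<noteq> [] \<and> distinct es \<and> set es \<subseteq> outgoing \<Gamma> Q \<and> list_all2 (leads_to \<Gamma>) es (rotate1 es) \<and>
     isolating \<Gamma> Q (total_rise \<Gamma> (set es))"

definition rigid_sets :: "('v, 'e) gbs \<Rightarrow> 'v point set \<Rightarrow> 'e set set" where
  "rigid_sets \<Gamma> Q = set ` {es. rigid_list \<Gamma> Q es}"

lemma list_all2_rotate1:
  "list_all2 R xs ys \<Longrightarrow> list_all2 R (rotate1 xs) (rotate1 ys)"
  by (cases xs; cases ys) (auto intro: list_all2_appendI)

lemma rigid_list_rotate: "rigid_list \<Gamma> Q es \<Longrightarrow> rigid_list \<Gamma> Q (rotate n es)"
  by (induction n) (auto simp: rigid_list_def intro: list_all2_rotate1)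

lemma rotations_rotate: "rotations (rotate n xs) = rotations xs"
proof (cases "xs = []")
  case False
  have "rotate m xs \<in> rotations (rotate n xs)" for m
  proof -
    have "m + n * (length xs - 1) + n = m + n * length xs"
      using False by (cases xs) auto
    then have "rotate (m + n * (length xs - 1)) (rotate n xs) = rotate (m + n * length xs) xs"
      by (simp only: rotate_rotate)
    also have "\<dots> = rotate ((m + n * length xs) mod length xs) xs"
      by (rule rotate_conv_mod)
    also have "\<dots> = rotate (m mod length xs) xs"
      by simp
    also have "\<dots> = rotate m xs"
      by (rule rotate_conv_mod[symmetric])
    finally have "rotate (m + n * (length xs - 1)) (rotate n xs) = rotate m xs" .
    then show ?thesis
      unfolding rotations_def by (metis rangeI)
  qed
  then show ?thesis
    by (auto simp: rotations_def rotate_rotate)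
qed (simp add: rotations_def)

lemma sum_rotate1_nth:
  assumes "distinct xs"
  shows "(\<Sum>i<length xs. f (rotate1 xs ! i)) = sum f (set xs)"
  using sum.reindex_bij_betw[OF bij_betw_nth[of "rotate1 xs"], of "{..<length xs}" "set xs" f] assms
  by simp

text \<open>
  Around a cycle, the rises of the edges and the gaps between the head of an edge and the tail of
  the next one have the same sum.
\<close>

lemma total_rise_eq_sum_gaps:
  fixes es :: "'e list"
  assumes "distinct es"
  shows "total_rise \<Gamma> (set es)
    = (\<Sum>i<length es. snd (tau \<Gamma> (es ! i)) - snd (iota \<Gamma> (rotate1 es ! i)))"
proof -
  have "(\<Sum>i<length es. snd (tau \<Gamma> (es ! i))) = (\<Sum>e \<in> set es. snd (tau \<Gamma> e))"
    using sum.reindex_bij_betw[OF bij_betw_nth[of es], of "{..<length es}" "set es"] assms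
    by simp
  then show ?thesis
    using sum_rotate1_nth[OF assms, of "\<lambda>e. snd (iota \<Gamma> e)"]
    by (simp only: total_rise_def sum_subtractf)
qed

locale clean_gbs =
  fixes \<Gamma> :: "('v, 'e) gbs" and Q :: "'v point set"
  assumes gbs: "gbs_graph \<Gamma>" and one_qc: "one_qc_class \<Gamma> Q"
    and clean: "clean \<Gamma> Q" and no_floating: "\<not> floating_pieces \<Gamma> Q"
begin

lemma qc: "qc_class \<Gamma> Q"
  using one_qc by (simp add: one_qc_class_def)

lemma endpoints_in_Q: "e \<in> Edges \<Gamma> \<Longrightarrow> iota \<Gamma> e \<in> Q" "e \<in> Edges \<Gamma> \<Longrightarrow> tau \<Gamma> e \<in> Q"
  using one_qc by (simp_all add: one_qc_class_def)

lemma tau_outgoing: "e \<in> outgoing \<Gamma> Q \<Longrightarrow> tau \<Gamma> e \<notin> min_qc \<Gamma> Q"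
  using clean by (auto simp: clean_def outgoing_def)

lemma outgoing_unique:
  assumes "e \<in> outgoing \<Gamma> Q" "f \<in> outgoing \<Gamma> Q" "iota \<Gamma> f \<in> at_point (iota \<Gamma> e)"
  shows "f = e"
proof -
  have "\<exists>!g. g \<in> Edges \<Gamma> \<and> iota \<Gamma> g \<in> at_point (iota \<Gamma> e)"
    using clean assms(1) by (auto simp: clean_def outgoing_def)
  then show ?thesis
    using assms at_point_self[of "iota \<Gamma> e"] by (auto simp: outgoing_def)
qed

lemma outgoing_at_min:
  assumes "m \<in> min_qc \<Gamma> Q"
  obtains e where "e \<in> outgoing \<Gamma> Q" "iota \<Gamma> e \<in> at_point m"
proof -
  obtain e where "e \<in> Edges \<Gamma>" "iota \<Gamma> e \<in> at_point m"
    using clean assms by (auto simp: clean_def)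
  then show ?thesis
    using that min_qc_at_point[OF qc assms] by (auto simp: outgoing_def)
qed

lemma exists_outgoing_below:
  assumes "x \<in> Q"
  obtains e where "e \<in> outgoing \<Gamma> Q" "point_le \<Gamma> (iota \<Gamma> e) x"
proof -
  obtain m where m: "m \<in> min_qc \<Gamma> Q" "point_le \<Gamma> m x"
    using exists_min_qc_below[OF gbs qc assms] by blast
  then obtain e where e: "e \<in> outgoing \<Gamma> Q" "iota \<Gamma> e \<in> at_point m"
    using outgoing_at_min by blast
  then have "point_le \<Gamma> (iota \<Gamma> e) m"
    using at_point_iff_point_le by blast
  then show ?thesis
    using that e(1) point_le_trans[OF _ m(2)] by blast
qed

text \<open>
  By cleanness there are at least as many edges as minimal points, with a distinct edge at each of
  them; without floating pieces the counts agree, and no edge is left over.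
\<close>

lemma outgoing_or_bar_outgoing:
  assumes "e \<in> Edges \<Gamma>"
  shows "e \<in> outgoing \<Gamma> Q \<or> bar \<Gamma> e \<in> outgoing \<Gamma> Q"
proof -
  let ?O = "outgoing \<Gamma> Q" and ?cls = "\<lambda>e. {e, bar \<Gamma> e}"
  have sub: "?O \<subseteq> Edges \<Gamma>"
    by (auto simp: outgoing_def)
  then have fin: "finite ?O"
    using finite_Edges[OF gbs] finite_subset by blast
  have "at_point ` min_qc \<Gamma> Q \<subseteq> (\<lambda>e. at_point (iota \<Gamma> e)) ` ?O"
  proof
    fix A assume "A \<in> at_point ` min_qc \<Gamma> Q"
    then obtain m where m: "m \<in> min_qc \<Gamma> Q" "A = at_point m" by blast
    then obtain f where "f \<in> ?O" "iota \<Gamma> f \<in> at_point m"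
      using outgoing_at_min by blast
    then show "A \<in> (\<lambda>e. at_point (iota \<Gamma> e)) ` ?O"
      using m at_point_eq_iff by blast
  qed
  then have "card (at_point ` min_qc \<Gamma> Q) \<le> card ?O"
    using fin surj_card_le by blast
  then have "card (?cls ` Edges \<Gamma>) \<le> card ?O"
    using no_floating by (simp add: floating_pieces_def)
  moreover have "inj_on ?cls ?O"
  proof (rule inj_onI)
    fix e f assume ef: "e \<in> ?O" "f \<in> ?O" "?cls e = ?cls f"
    have "f \<noteq> bar \<Gamma> e"
      using ef(1,2) tau_outgoing iota_bar[OF gbs] by (auto simp: outgoing_def)
    then show "e = f"
      using ef(3) by (simp add: doubleton_eq_iff)
  qed
  ultimately have "card (?cls ` Edges \<Gamma>) \<le> card (?cls ` ?O)"
    by (simp add: card_image)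
  then have "?cls ` ?O = ?cls ` Edges \<Gamma>"
    by (intro card_seteq) (use sub finite_Edges[OF gbs] in auto)
  then obtain f where f: "f \<in> ?O" "?cls e = ?cls f"
    using assms by (metis (no_types, lifting) imageE imageI)
  then have "f = e \<or> f = bar \<Gamma> e"
    by (auto simp: doubleton_eq_iff)
  then show ?thesis
    using f(1) by auto
qed

lemma outgoing_iff_tau:
  assumes "e \<in> Edges \<Gamma>"
  shows "bar \<Gamma> e \<in> outgoing \<Gamma> Q \<longleftrightarrow> e \<notin> outgoing \<Gamma> Q"
  using outgoing_or_bar_outgoing[OF assms] tau_outgoing[of e] iota_bar[OF gbs, of e]
  by (auto simp: outgoing_def)

text \<open>
  Otherwise the head of \<open>d\<close> would be minimal, hence identified with the tail of \<open>e\<close> below it, and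
  two different edges would have an endpoint there.
\<close>

lemma outgoing_if_head_above:
  assumes "e \<in> outgoing \<Gamma> Q" "d \<in> Edges \<Gamma>" "d \<notin> {e, bar \<Gamma> e}" "leads_to \<Gamma> d e"
  shows "d \<in> outgoing \<Gamma> Q"
proof (rule ccontr)
  assume "d \<notin> outgoing \<Gamma> Q"
  then have bar_d: "bar \<Gamma> d \<in> outgoing \<Gamma> Q"
    using outgoing_or_bar_outgoing assms(2) by blast
  then have "tau \<Gamma> d \<in> min_qc \<Gamma> Q"
    using iota_bar[OF gbs] by (simp add: outgoing_def)
  moreover have "iota \<Gamma> e \<in> Q"
    using assms(1) endpoints_in_Q by (simp add: outgoing_def)
  ultimately have "iota \<Gamma> (bar \<Gamma> d) \<in> at_point (iota \<Gamma> e)"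
    using assms(4) min_qc_downward(2) iota_bar[OF gbs] unfolding leads_to_def by metis
  then have "bar \<Gamma> d = e"
    using outgoing_unique assms(1) bar_d by blast
  then show False
    using assms(3) bar_bar[OF gbs, of d] by auto
qed

text \<open>
  The last condition on a rigid cycle makes it deterministic: each gap is at most the rigid vector,
  so the head of an edge of the cycle lies above one minimal point only.
\<close>

lemma rigid_list_next:
  assumes es: "rigid_list \<Gamma> Q es" and i: "i < length es"
    and f: "f \<in> outgoing \<Gamma> Q" "leads_to \<Gamma> (es ! i) f"
  shows "rotate1 es ! i = f"
proof -
  let ?gap = "\<lambda>i. snd (tau \<Gamma> (es ! i)) - snd (iota \<Gamma> (rotate1 es ! i))"
  let ?w = "total_rise \<Gamma> (set es)" and ?g = "rotate1 es ! i"
  have le: "point_le \<Gamma> (iota \<Gamma> (rotate1 es ! j)) (tau \<Gamma> (es ! j))" if "j < length es" for j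
    using es that by (auto simp: rigid_list_def list_all2_conv_all_nth leads_to_def)
  have g: "?g \<in> outgoing \<Gamma> Q"
    using es i nth_mem[of i "rotate1 es"] by (auto simp: rigid_list_def)
  have "?w = ?gap i + sum ?gap ({..<length es} - {i})"
    using es i by (simp add: rigid_list_def total_rise_eq_sum_gaps sum.remove[of _ i])
  moreover have "sum ?gap ({..<length es} - {i}) \<in> Apos \<Gamma>"
    using le by (intro sum_in_Apos) (auto simp: point_le_iff)
  ultimately have "?w - ?gap i \<in> Apos \<Gamma>"
    by simp
  then have "point_le \<Gamma> (tau \<Gamma> (es ! i)) (iota \<Gamma> ?g \<oplus>\<^sub>p ?w)"
    using le[OF i] by (simp add: point_le_iff shift_def algebra_simps)
  then have "point_le \<Gamma> (iota \<Gamma> f) (iota \<Gamma> ?g \<oplus>\<^sub>p ?w)"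
    using f(2) point_le_trans unfolding leads_to_def by blast
  then have "iota \<Gamma> f \<in> at_point (iota \<Gamma> ?g)"
    using es f(1) g by (auto simp: rigid_list_def isolating_def outgoing_def)
  then show ?thesis
    using outgoing_unique f(1) g by blast
qed

lemma rigid_set_start:
  assumes "C \<in> rigid_sets \<Gamma> Q" "x \<in> C"
  obtains xs where "rigid_list \<Gamma> Q (x # xs)" "set (x # xs) = C"
proof -
  obtain es where es: "rigid_list \<Gamma> Q es" "set es = C"
    using assms(1) by (auto simp: rigid_sets_def)
  then obtain i where i: "i < length es" "es ! i = x"
    using assms(2) by (metis in_set_conv_nth)
  have "hd (rotate i es) = x" "rotate i es \<noteq> []"
    using i hd_rotate_conv_nth[of es i] by (cases es; force)+
  then have "rotate i es = x # tl (rotate i es)"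
    by (metis list.collapse)
  then show ?thesis
    using that[of "tl (rotate i es)"] rigid_list_rotate[OF es(1), of i] es(2)
    by (metis set_rotate)
qed

text \<open>
  Start both sequences at the same edge; they then agree, since each edge has only one successor.
\<close>

lemma rigid_list_rotations_eq:
  assumes "rigid_list \<Gamma> Q es" "rigid_list \<Gamma> Q fs" "set es = set fs"
  shows "rotations es = rotations fs"
proof -
  have "hd es \<in> set fs"
    using assms by (metis rigid_list_def hd_in_set)
  then obtain j where j: "j < length fs" "fs ! j = hd es"
    by (metis in_set_conv_nth)
  define gs where "gs = rotate j fs"
  have gs: "rigid_list \<Gamma> Q gs" "set gs = set es"
    using assms rigid_list_rotate by (auto simp: gs_def)
  have len: "length gs = length es"
    using assms(1) gs by (metis distinct_card rigid_list_def)
  have "gs ! i = es ! i" if "i < length es" for i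
    using that
  proof (induction i)
    case 0
    have "fs \<noteq> []"
      using j by auto
    then have "hd gs = hd es"
      using j hd_rotate_conv_nth[of fs j] by (simp add: gs_def)
    then show ?case
      using 0 len by (metis hd_conv_nth length_greater_0_conv)
  next
    case (Suc i)
    then have i: "i < length es" "gs ! i = es ! i" and next_nth: "rotate1 es ! i = es ! Suc i"
      "rotate1 gs ! i = gs ! Suc i"
      using len by (simp_all add: nth_rotate1)
    have "gs ! Suc i \<in> outgoing \<Gamma> Q"
      using gs(1) Suc.prems len nth_mem[of "Suc i" gs] by (auto simp: rigid_list_def)
    moreover have "leads_to \<Gamma> (gs ! i) (gs ! Suc i)"
      using gs(1) i(1) len next_nth(2)
      by (auto simp: rigid_list_def list_all2_conv_all_nth)
    ultimately show ?case
      using rigid_list_next[OF assms(1) i(1)] i(2) next_nth(1) by simp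
  qed
  then have "gs = es"
    using len by (intro nth_equalityI) auto
  then show ?thesis
    using rotations_rotate[of j fs] by (simp add: gs_def)
qed

lemma rigid_cycle_iff_rigid_list:
  "rigid_cycle \<Gamma> Q es ws \<longleftrightarrow> rigid_list \<Gamma> Q es \<and> length ws = length es \<and>
    (\<forall>i < length es. ws ! i = snd (tau \<Gamma> (es ! i)) - snd (iota \<Gamma> (rotate1 es ! i)))"
  (is "?L \<longleftrightarrow> ?R")
proof -
  let ?gap = "\<lambda>i. snd (tau \<Gamma> (es ! i)) - snd (iota \<Gamma> (rotate1 es ! i))"
  have sum_ws: "sum_list ws = total_rise \<Gamma> (set es)"
    if "distinct es" "length ws = length es" "\<forall>i < length es. ws ! i = ?gap i"
    using that by (simp add: total_rise_eq_sum_gaps sum_list_sum_nth atLeast0LessThan)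
  show ?thesis
  proof
    assume L: ?L
    then have out: "set es \<subseteq> outgoing \<Gamma> Q"
      by (auto simp: rigid_cycle_def outgoing_def in_set_conv_nth)
    have dist: "distinct es"
      using L at_point_self unfolding distinct_conv_nth rigid_cycle_def by metis
    have tau: "tau \<Gamma> (es ! i) = iota \<Gamma> (rotate1 es ! i) \<oplus>\<^sub>p ws ! i" if "i < length es" for i
      using L that by (simp add: rigid_cycle_def nth_rotate1)
    have Apos: "ws ! i \<in> Apos \<Gamma>" if "i < length es" for i
      using L that nth_mem[of i ws] by (auto simp: rigid_cycle_def)
    have "list_all2 (leads_to \<Gamma>) es (rotate1 es)"
      using tau Apos by (auto simp: list_all2_conv_all_nth leads_to_def intro: point_le_shift)
    moreover have gap: "ws ! i = ?gap i" if "i < length es" for i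
      using tau[OF that] by simp
    moreover have "sum_list ws = total_rise \<Gamma> (set es)"
      using sum_ws dist gap L by (simp add: rigid_cycle_def)
    ultimately show ?R
      using L out dist by (simp add: rigid_cycle_def rigid_list_def isolating_def)
  next
    assume R: ?R
    have le: "point_le \<Gamma> (iota \<Gamma> (rotate1 es ! i)) (tau \<Gamma> (es ! i))" if "i < length es" for i
      using R that by (auto simp: rigid_list_def list_all2_conv_all_nth leads_to_def)
    have out: "es ! i \<in> outgoing \<Gamma> Q" if "i < length es" for i
    proof -
      have "set es \<subseteq> outgoing \<Gamma> Q"
        using R by (simp add: rigid_list_def)
      then show ?thesis
        using nth_mem[OF that] by blast
    qed
    have "set ws \<subseteq> Apos \<Gamma>"
    proof
      fix w assume "w \<in> set ws"
      then obtain i where "i < length es" "w = ?gap i"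
        using R by (auto simp only: in_set_conv_nth)
      then show "w \<in> Apos \<Gamma>"
        using le point_le_iff by blast
    qed
    moreover have "tau \<Gamma> (es ! i) = iota \<Gamma> (es ! (Suc i mod length es)) \<oplus>\<^sub>p ws ! i"
      if "i < length es" for i
      using R le[OF that] that by (simp add: point_le_iff shift_def nth_rotate1)
    moreover have "iota \<Gamma> (es ! j) \<notin> at_point (iota \<Gamma> (es ! i))"
      if "i < length es" "j < length es" "i \<noteq> j" for i j
    proof
      assume "iota \<Gamma> (es ! j) \<in> at_point (iota \<Gamma> (es ! i))"
      then have "es ! j = es ! i"
        by (rule outgoing_unique[OF out[OF that(1)] out[OF that(2)]])
      then show False
        using R that by (simp add: rigid_list_def nth_eq_iff_index_eq)
    qed
    moreover have "iota \<Gamma> (es ! i) \<in> min_qc \<Gamma> Q" if "i < length es" for i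
      using out[OF that] by (simp add: outgoing_def)
    moreover have "set es \<subseteq> Edges \<Gamma>"
      using R by (auto simp: rigid_list_def outgoing_def)
    moreover have "sum_list ws = total_rise \<Gamma> (set es)"
      using sum_ws R by (simp add: rigid_list_def)
    ultimately show ?L
      using R by (simp add: rigid_cycle_def rigid_list_def isolating_def)
  qed
qed

lemma sum_list_rigid_cycle:
  assumes "rigid_cycle \<Gamma> Q es ws"
  shows "sum_list ws = total_rise \<Gamma> (set es)"
  using assms unfolding rigid_cycle_iff_rigid_list
  by (simp add: rigid_list_def total_rise_eq_sum_gaps sum_list_sum_nth atLeast0LessThan)

lemma exists_rigid_cycle:
  assumes "rigid_list \<Gamma> Q es"
  shows "\<exists>ws. rigid_cycle \<Gamma> Q es ws"
  unfolding rigid_cycle_iff_rigid_list using assms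
  by (intro exI[of _ "map (\<lambda>i. snd (tau \<Gamma> (es ! i)) - snd (iota \<Gamma> (rotate1 es ! i))) [0..<length es]"])
    simp

text \<open>
  Taking the union of the sets of the rotations maps the rigid cycles up to rotation bijectively to
  their edge sets.
\<close>

lemma rigid_vectors_eq_total_rises:
  "rigid_vectors \<Gamma> Q = image_mset (total_rise \<Gamma>) (mset_set (rigid_sets \<Gamma> Q))"
proof -
  let ?X = "{(rotations es, sum_list ws) | es ws. rigid_cycle \<Gamma> Q es ws}"
  let ?h = "\<lambda>x. \<Union> (set ` fst x)"
  have X: "?X = (\<lambda>es. (rotations es, total_rise \<Gamma> (set es))) ` {es. rigid_list \<Gamma> Q es}"
  proof (intro equalityI subsetI)
    fix x assume "x \<in> ?X"
    then obtain es ws where "x = (rotations es, sum_list ws)" "rigid_cycle \<Gamma> Q es ws"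
      by blast
    then show "x \<in> (\<lambda>es. (rotations es, total_rise \<Gamma> (set es))) ` {es. rigid_list \<Gamma> Q es}"
      using sum_list_rigid_cycle by (auto simp: rigid_cycle_iff_rigid_list)
  next
    fix x assume "x \<in> (\<lambda>es. (rotations es, total_rise \<Gamma> (set es))) ` {es. rigid_list \<Gamma> Q es}"
    then obtain es where es: "x = (rotations es, total_rise \<Gamma> (set es))" "rigid_list \<Gamma> Q es"
      by blast
    then obtain ws where "rigid_cycle \<Gamma> Q es ws"
      using exists_rigid_cycle by blast
    then show "x \<in> ?X"
      using es(1) sum_list_rigid_cycle by (intro CollectI exI[of _ es] exI[of _ ws]) simp
  qed
  have union: "\<Union> (set ` rotations es) = set es" for es :: "'e list"
    by (auto simp: rotations_def)
  have img: "?h ` ?X = rigid_sets \<Gamma> Q"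
    unfolding X rigid_sets_def image_image by (simp add: union)
  have inj: "inj_on ?h ?X"
  proof (rule inj_onI)
    fix x y assume "x \<in> ?X" "y \<in> ?X" and eq: "?h x = ?h y"
    then obtain es fs where es: "rigid_list \<Gamma> Q es" "x = (rotations es, total_rise \<Gamma> (set es))"
      and fs: "rigid_list \<Gamma> Q fs" "y = (rotations fs, total_rise \<Gamma> (set fs))"
      unfolding X by blast
    have "set es = set fs"
      using eq unfolding es(2) fs(2) fst_conv union .
    then show "x = y"
      using rigid_list_rotations_eq[OF es(1) fs(1)] es(2) fs(2) by simp
  qed
  have "image_mset (total_rise \<Gamma>) (mset_set (rigid_sets \<Gamma> Q))
      = image_mset (\<lambda>x. total_rise \<Gamma> (?h x)) (mset_set ?X)"
    by (simp only: img[symmetric] image_mset_mset_set[OF inj, symmetric] multiset.map_comp comp_def)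
  also have "\<dots> = image_mset snd (mset_set ?X)"
  proof (rule image_mset_cong)
    fix x assume "x \<in># mset_set ?X"
    then have "x \<in> ?X"
      by (cases "finite ?X") simp_all
    then show "total_rise \<Gamma> (?h x) = snd x"
      unfolding X by (auto simp: union)
  qed
  finally show ?thesis
    by (simp add: rigid_vectors_def)
qed

end

lemma rigid_vectors_eqI:
  assumes "clean_gbs \<Gamma> Q" "clean_gbs \<Gamma>' Q"
    and bij: "bij_betw f (rigid_sets \<Gamma> Q) (rigid_sets \<Gamma>' Q)"
    and rise: "\<And>C. C \<in> rigid_sets \<Gamma> Q \<Longrightarrow> total_rise \<Gamma>' (f C) = total_rise \<Gamma> C"
  shows "rigid_vectors \<Gamma>' Q = rigid_vectors \<Gamma> Q"
proof -
  have "mset_set (rigid_sets \<Gamma>' Q) = image_mset f (mset_set (rigid_sets \<Gamma> Q))"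
    using bij by (simp add: image_mset_mset_set bij_betw_def)
  then have "rigid_vectors \<Gamma>' Q
      = image_mset (\<lambda>C. total_rise \<Gamma>' (f C)) (mset_set (rigid_sets \<Gamma> Q))"
    by (simp add: clean_gbs.rigid_vectors_eq_total_rises[OF assms(2)] multiset.map_comp comp_def)
  also have "\<dots> = image_mset (total_rise \<Gamma>) (mset_set (rigid_sets \<Gamma> Q))"
  proof (rule image_mset_cong)
    fix C assume "C \<in># mset_set (rigid_sets \<Gamma> Q)"
    then have "C \<in> rigid_sets \<Gamma> Q"
      by (cases "finite (rigid_sets \<Gamma> Q)") simp_all
    then show "total_rise \<Gamma>' (f C) = total_rise \<Gamma> C"
      by (rule rise)
  qed
  finally show ?thesis
    by (simp add: clean_gbs.rigid_vectors_eq_total_rises[OF assms(1)])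
qed

section \<open>Moves preserve conjugacy\<close>

lemma edge_between_bar:
  "gbs_graph \<Gamma> \<Longrightarrow> edge_between \<Gamma> e p q \<Longrightarrow> edge_between \<Gamma> (bar \<Gamma> e) q p"
  by (auto simp: edge_between_def tau_bar)

lemma edge_between_points:
  assumes "gbs_graph \<Gamma>" "edge_between \<Gamma> e p q"
  shows "p \<in> points \<Gamma>" "q \<in> points \<Gamma>" "snd p \<in> Apos \<Gamma>" "snd q \<in> Apos \<Gamma>"
proof -
  show "p \<in> points \<Gamma>" "q \<in> points \<Gamma>"
    using assms(2) iota_in_points[OF assms(1)] tau_in_points[OF assms(1)]
    by (auto simp: edge_between_def)
  then show "snd p \<in> Apos \<Gamma>" "snd q \<in> Apos \<Gamma>"
    by (simp_all add: snd_points)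
qed

lemma unchanged_except_sym:
  "unchanged_except D \<Gamma> \<Gamma>' \<Longrightarrow> unchanged_except D \<Gamma>' \<Gamma>"
  by (simp add: unchanged_except_def)

lemma unchanged_except_bar:
  assumes "gbs_graph \<Gamma>" "unchanged_except (insert e D) \<Gamma> \<Gamma>'"
  shows "unchanged_except (insert (bar \<Gamma> e) D) \<Gamma> \<Gamma>'"
proof -
  have "f \<noteq> bar \<Gamma> e \<longleftrightarrow> bar \<Gamma> f \<noteq> e" for f
    using bar_bar[OF assms(1)] by metis
  then show ?thesis
    using assms(2) unfolding unchanged_except_def by (metis insert_iff)
qed

lemma endpoints_unchanged:
  assumes "unchanged_except D \<Gamma> \<Gamma>'" "e \<in> Edges \<Gamma>" "e \<notin> D" "bar \<Gamma> e \<notin> D"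
  shows "iota \<Gamma>' e = iota \<Gamma> e" "tau \<Gamma>' e = tau \<Gamma> e"
  using assms unfolding unchanged_except_def by blast+

lemma endpoints_bar_unchanged:
  assumes "gbs_graph \<Gamma>'" "unchanged_except D \<Gamma> \<Gamma>'" "e \<in> Edges \<Gamma>"
  shows "iota \<Gamma>' (bar \<Gamma> e) = tau \<Gamma>' e" "tau \<Gamma>' (bar \<Gamma> e) = iota \<Gamma>' e"
  using assms iota_bar[OF assms(1), of e] tau_bar[of \<Gamma>' e]
  by (simp_all add: unchanged_except_def)

text \<open>
  The set of primes is the union of the supports of all endpoints, so that it can be compared
  on the edges that change.
\<close>

lemma Apos_subset_if_unchanged_except:
  assumes gbs: "gbs_graph \<Gamma>" "gbs_graph \<Gamma>'" and U: "unchanged_except D \<Gamma> \<Gamma>'"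
    and D: "\<And>e. e \<in> D \<Longrightarrow> snd (iota \<Gamma> e) \<in> Apos \<Gamma>' \<and> snd (tau \<Gamma> e) \<in> Apos \<Gamma>'"
  shows "Apos \<Gamma> \<subseteq> Apos \<Gamma>'"
proof -
  have tau: "snd (tau \<Gamma> e) \<in> Apos \<Gamma>'" if e: "e \<in> Edges \<Gamma>" for e
  proof -
    consider "e \<in> D" | "bar \<Gamma> e \<in> D" | "e \<notin> D" "bar \<Gamma> e \<notin> D"
      by blast
    then show ?thesis
    proof cases
      case 1
      then show ?thesis using D by blast
    next
      case 2
      then show ?thesis using D[of "bar \<Gamma> e"] gbs by simp
    next
      case 3
      moreover have "e \<in> Edges \<Gamma>'"
        using U e by (simp add: unchanged_except_def)
      ultimately show ?thesis
        using tau_in_points[OF gbs(2)] snd_points endpoints_unchanged(2)[OF U e] by metis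
    qed
  qed
  have "prime_set \<Gamma> \<subseteq> prime_set \<Gamma>'"
  proof
    fix r assume "r \<in> prime_set \<Gamma>"
    then obtain e where e: "e \<in> Edges \<Gamma>" "r \<in> supp (snd (tau \<Gamma> e))"
      using prime_set_eq_supports[OF gbs(1)] by blast
    show "r \<in> prime_set \<Gamma>'"
      using tau[OF e(1)] e(2) unfolding Apos_def supp_def by blast
  qed
  then show ?thesis
    by (auto simp: Apos_def)
qed

lemma conjugate_endpoints_if_unchanged_except:
  assumes gbs: "gbs_graph \<Gamma>" "gbs_graph \<Gamma>'" and U: "unchanged_except D \<Gamma> \<Gamma>'"
    and D: "\<And>e. e \<in> D \<Longrightarrow> conjugate \<Gamma> (iota \<Gamma>' e) (tau \<Gamma>' e)"
    and e: "e \<in> Edges \<Gamma>"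
  shows "conjugate \<Gamma> (iota \<Gamma>' e) (tau \<Gamma>' e)"
proof -
  consider "e \<in> D" | "bar \<Gamma> e \<in> D" | "e \<notin> D" "bar \<Gamma> e \<notin> D"
    by blast
  then show ?thesis
  proof cases
    case 1
    then show ?thesis by (rule D)
  next
    case 2
    then show ?thesis
      using conjugate_sym[OF gbs(1) D] endpoints_bar_unchanged[OF gbs(2) U e] by metis
  next
    case 3
    then show ?thesis
      using conjugate_edge[OF gbs(1) e] endpoints_unchanged[OF U e] by simp
  qed
qed

lemma edge_sign_change_Apos:
  assumes "gbs_graph \<Gamma>" "gbs_graph \<Gamma>'" "edge_sign_change \<Gamma> \<Gamma>'"
  shows "Apos \<Gamma> \<subseteq> Apos \<Gamma>'"
proof -
  obtain e p q where E: "edge_between \<Gamma> e p q" "edge_between \<Gamma>' e (p \<oplus>\<^sub>p eps) (q \<oplus>\<^sub>p eps)"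
    and U: "unchanged_except {e} \<Gamma> \<Gamma>'"
    using assms(3) unfolding edge_sign_change_def by blast
  have "snd p + eps \<in> Apos \<Gamma>'" "snd q + eps \<in> Apos \<Gamma>'"
    using edge_between_points(3,4)[OF assms(2) E(2)] by simp_all
  then have "snd p \<in> Apos \<Gamma>'" "snd q \<in> Apos \<Gamma>'"
    using edge_between_points(3,4)[OF assms(1) E(1)] Apos_summands(1) eps_in_Apos by blast+
  then show ?thesis
    using E(1) by (intro Apos_subset_if_unchanged_except[OF assms(1,2) U])
      (simp add: edge_between_def)
qed

lemma slide_Apos:
  assumes "gbs_graph \<Gamma>" "gbs_graph \<Gamma>'" "slide \<Gamma> \<Gamma>'"
  shows "Apos \<Gamma> \<subseteq> Apos \<Gamma>'"
proof -
  obtain e d p q r a where a: "a \<in> Apos \<Gamma>"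
    and E: "edge_between \<Gamma> e p q" "edge_between \<Gamma> d r (p \<oplus>\<^sub>p a)"
      "edge_between \<Gamma>' e p q" "edge_between \<Gamma>' d r (q \<oplus>\<^sub>p a)"
    and U: "unchanged_except {e, d} \<Gamma> \<Gamma>'"
    using assms(3) unfolding slide_def by blast
  note in' = edge_between_points(3,4)[OF assms(2) E(3)]
    edge_between_points(3,4)[OF assms(2) E(4)]
  have "a \<in> Apos \<Gamma>'"
    using in' a Apos_summands(2)[of "snd q" a] by simp
  then have "snd p + a \<in> Apos \<Gamma>'"
    using in' add_in_Apos by blast
  then show ?thesis
    using E(1,2) in' by (intro Apos_subset_if_unchanged_except[OF assms(1,2) U])
      (auto simp: edge_between_def)
qed

lemma connection_Apos:
  assumes "gbs_graph \<Gamma>" "gbs_graph \<Gamma>'" "connection \<Gamma> \<Gamma>'"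
  shows "Apos \<Gamma> \<subseteq> Apos \<Gamma>'"
proof -
  obtain d e p q w w1 w2 and k :: nat
    where w: "w \<in> Apos \<Gamma>" "w1 \<in> Apos \<Gamma>" "w2 \<in> Apos \<Gamma>" "w1 + w2 = (\<Sum>i<k. w)"
    and E: "edge_between \<Gamma> d q (p \<oplus>\<^sub>p w1)" "edge_between \<Gamma> e p (p \<oplus>\<^sub>p w)"
      "edge_between \<Gamma>' d p (q \<oplus>\<^sub>p w2)" "edge_between \<Gamma>' e q (q \<oplus>\<^sub>p w)"
    and U: "unchanged_except {d, e} \<Gamma> \<Gamma>'"
    using assms(3) unfolding connection_def by blast
  note in' = edge_between_points(3,4)[OF assms(2) E(3)]
    edge_between_points(3,4)[OF assms(2) E(4)]
  have "w \<in> Apos \<Gamma>'"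
    using in' w Apos_summands(2)[of "snd q" w] by simp
  then have "w1 + w2 \<in> Apos \<Gamma>'"
    unfolding w(4) by (intro sum_in_Apos)
  then have "w1 \<in> Apos \<Gamma>'"
    using w Apos_summands(1) by blast
  then have "snd p + w1 \<in> Apos \<Gamma>'" "snd p + w \<in> Apos \<Gamma>'"
    using in' \<open>w \<in> Apos \<Gamma>'\<close> add_in_Apos by blast+
  then show ?thesis
    using E(1,2) in' by (intro Apos_subset_if_unchanged_except[OF assms(1,2) U])
      (auto simp: edge_between_def)
qed

definition move :: "('v, 'e) gbs \<Rightarrow> ('v, 'e) gbs \<Rightarrow> bool" where
  "move \<Gamma> \<Gamma>' \<longleftrightarrow> edge_sign_change \<Gamma> \<Gamma>' \<or> slide \<Gamma> \<Gamma>' \<or> connection \<Gamma> \<Gamma>'"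

lemma move_Apos:
  "gbs_graph \<Gamma> \<Longrightarrow> gbs_graph \<Gamma>' \<Longrightarrow> move \<Gamma> \<Gamma>' \<Longrightarrow> Apos \<Gamma> \<subseteq> Apos \<Gamma>'"
  unfolding move_def using edge_sign_change_Apos slide_Apos connection_Apos by blast

lemma edge_sign_change_sym: "edge_sign_change \<Gamma> \<Gamma>' \<Longrightarrow> edge_sign_change \<Gamma>' \<Gamma>"
  unfolding edge_sign_change_def by (metis shift_eps_eps unchanged_except_sym)

text \<open>
  The inverse of a slide over \<open>e\<close> is a slide over the reverse of \<open>e\<close>.
\<close>

lemma slide_sym:
  assumes "Apos \<Gamma> \<subseteq> Apos \<Gamma>'" "gbs_graph \<Gamma>" "slide \<Gamma> \<Gamma>'"
  shows "slide \<Gamma>' \<Gamma>"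
proof -
  obtain e d p q r a where a: "a \<in> Apos \<Gamma>" and d: "d \<notin> {e, bar \<Gamma> e}"
    and E: "edge_between \<Gamma> e p q" "edge_between \<Gamma> d r (p \<oplus>\<^sub>p a)"
      "edge_between \<Gamma>' e p q" "edge_between \<Gamma>' d r (q \<oplus>\<^sub>p a)"
    and U: "unchanged_except {e, d} \<Gamma> \<Gamma>'"
    using assms(3) unfolding slide_def by blast
  have e: "e \<in> Edges \<Gamma>"
    using E by (simp add: edge_between_def)
  have bars: "bar \<Gamma>' (bar \<Gamma> e) = e"
    using U e assms(2) by (simp add: unchanged_except_def)
  have E': "edge_between \<Gamma>' (bar \<Gamma> e) q p"
    using E(3) U e bars assms(2)
    by (simp add: edge_between_def unchanged_except_def iota_def)
  show ?thesis
    unfolding slide_def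
    using a d assms(1) bars E' edge_between_bar[OF assms(2) E(1)] E(2,4)
      unchanged_except_sym[OF unchanged_except_bar[OF assms(2) U]]
    by (intro exI[of _ "bar \<Gamma> e"] exI[of _ d] exI[of _ q] exI[of _ p] exI[of _ r] exI[of _ a]) auto
qed

text \<open>
  Exchanging \<open>p\<close> with \<open>q\<close> and \<open>w1\<close> with \<open>w2\<close> inverts a connection.
\<close>

lemma connection_sym:
  assumes "Apos \<Gamma> \<subseteq> Apos \<Gamma>'" "connection \<Gamma> \<Gamma>'"
  shows "connection \<Gamma>' \<Gamma>"
proof -
  obtain d e p q w w1 w2 and k :: nat
    where w: "w \<in> Apos \<Gamma>" "w1 \<in> Apos \<Gamma>" "w2 \<in> Apos \<Gamma>" "w1 + w2 = (\<Sum>i<k. w)"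
    and d: "d \<notin> {e, bar \<Gamma> e}"
    and E: "edge_between \<Gamma> d q (p \<oplus>\<^sub>p w1)" "edge_between \<Gamma> e p (p \<oplus>\<^sub>p w)"
      "edge_between \<Gamma>' d p (q \<oplus>\<^sub>p w2)" "edge_between \<Gamma>' e q (q \<oplus>\<^sub>p w)"
    and U: "unchanged_except {d, e} \<Gamma> \<Gamma>'"
    using assms(2) unfolding connection_def by blast
  have "bar \<Gamma>' e = bar \<Gamma> e"
    using U E(2) by (simp add: unchanged_except_def edge_between_def)
  then show ?thesis
    unfolding connection_def
    using w d E assms(1) unchanged_except_sym[OF U]
    by (intro exI[of _ d] exI[of _ e] exI[of _ q] exI[of _ p] exI[of _ w] exI[of _ w2]
        exI[of _ w1] exI[of _ k]) (auto simp: add.commute)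
qed

lemma move_sym:
  "gbs_graph \<Gamma> \<Longrightarrow> gbs_graph \<Gamma>' \<Longrightarrow> move \<Gamma> \<Gamma>' \<Longrightarrow> move \<Gamma>' \<Gamma>"
  using move_Apos[of \<Gamma> \<Gamma>'] edge_sign_change_sym slide_sym connection_sym unfolding move_def by blast

lemma edge_between_conjugate:
  "gbs_graph \<Gamma> \<Longrightarrow> edge_between \<Gamma> e p q \<Longrightarrow> conjugate \<Gamma> p q"
  using conjugate_edge[of \<Gamma> e] by (auto simp: edge_between_def)

lemma conjugate_shift_multiple:
  assumes "conjugate \<Gamma> p (p \<oplus>\<^sub>p w)" "w \<in> Apos \<Gamma>"
  shows "conjugate \<Gamma> p (p \<oplus>\<^sub>p (\<Sum>i<k::nat. w))"
proof (induction k)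
  case 0
  have "p \<in> points \<Gamma>"
    using assms(1) by (simp add: conjugate_def)
  then show ?case
    by (simp add: conjugate_refl)
next
  case (Suc k)
  have "conjugate \<Gamma> (p \<oplus>\<^sub>p w) (p \<oplus>\<^sub>p (\<Sum>i<k. w) \<oplus>\<^sub>p w)"
    by (rule conjugate_shift[OF Suc assms(2)])
  then have "conjugate \<Gamma> p (p \<oplus>\<^sub>p (\<Sum>i<k. w) \<oplus>\<^sub>p w)"
    by (rule conjugate_trans[OF assms(1)])
  then show ?case
    by (simp add: shift_shift add.commute)
qed

lemma edge_sign_change_conjugate:
  assumes "gbs_graph \<Gamma>" "gbs_graph \<Gamma>'" "edge_sign_change \<Gamma> \<Gamma>'" "f \<in> Edges \<Gamma>"
  shows "conjugate \<Gamma> (iota \<Gamma>' f) (tau \<Gamma>' f)"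
proof -
  obtain e p q where E: "edge_between \<Gamma> e p q" "edge_between \<Gamma>' e (p \<oplus>\<^sub>p eps) (q \<oplus>\<^sub>p eps)"
    and U: "unchanged_except {e} \<Gamma> \<Gamma>'"
    using assms(3) unfolding edge_sign_change_def by blast
  have "conjugate \<Gamma> (p \<oplus>\<^sub>p eps) (q \<oplus>\<^sub>p eps)"
    by (rule conjugate_shift[OF edge_between_conjugate[OF assms(1) E(1)] eps_in_Apos])
  then show ?thesis
    using E(2)
    by (intro conjugate_endpoints_if_unchanged_except[OF assms(1,2) U _ assms(4)])
      (simp add: edge_between_def)
qed

lemma slide_conjugate:
  assumes "gbs_graph \<Gamma>" "gbs_graph \<Gamma>'" "slide \<Gamma> \<Gamma>'" "f \<in> Edges \<Gamma>"
  shows "conjugate \<Gamma> (iota \<Gamma>' f) (tau \<Gamma>' f)"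
proof -
  obtain e d p q r a where a: "a \<in> Apos \<Gamma>"
    and E: "edge_between \<Gamma> e p q" "edge_between \<Gamma> d r (p \<oplus>\<^sub>p a)"
      "edge_between \<Gamma>' e p q" "edge_between \<Gamma>' d r (q \<oplus>\<^sub>p a)"
    and U: "unchanged_except {e, d} \<Gamma> \<Gamma>'"
    using assms(3) unfolding slide_def by blast
  have pq: "conjugate \<Gamma> p q"
    by (rule edge_between_conjugate[OF assms(1) E(1)])
  have "conjugate \<Gamma> r (q \<oplus>\<^sub>p a)"
    by (rule conjugate_trans[OF edge_between_conjugate[OF assms(1) E(2)] conjugate_shift[OF pq a]])
  then show ?thesis
    using E(3,4) pq
    by (intro conjugate_endpoints_if_unchanged_except[OF assms(1,2) U _ assms(4)])
      (auto simp: edge_between_def)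
qed

text \<open>
  The new endpoints are conjugate in the old graph:
  \<open>q + w2\<close> is conjugate to \<open>p + w1 + w2 = p + k w\<close>, which is conjugate to \<open>p\<close> by running \<open>k\<close> times
  around the loop; and \<open>q + w\<close> is conjugate to \<open>q\<close> by way of \<open>p + w1 + w\<close> and \<open>p + w1\<close>.
\<close>

lemma connection_conjugate:
  assumes "gbs_graph \<Gamma>" "gbs_graph \<Gamma>'" "connection \<Gamma> \<Gamma>'" "f \<in> Edges \<Gamma>"
  shows "conjugate \<Gamma> (iota \<Gamma>' f) (tau \<Gamma>' f)"
proof -
  obtain d e p q w w1 w2 and k :: nat
    where w: "w \<in> Apos \<Gamma>" "w1 \<in> Apos \<Gamma>" "w2 \<in> Apos \<Gamma>" "w1 + w2 = (\<Sum>i<k. w)"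
    and E: "edge_between \<Gamma> d q (p \<oplus>\<^sub>p w1)" "edge_between \<Gamma> e p (p \<oplus>\<^sub>p w)"
      "edge_between \<Gamma>' d p (q \<oplus>\<^sub>p w2)" "edge_between \<Gamma>' e q (q \<oplus>\<^sub>p w)"
    and U: "unchanged_except {d, e} \<Gamma> \<Gamma>'"
    using assms(3) unfolding connection_def by blast
  note conj = edge_between_conjugate[OF assms(1)]
  have "conjugate \<Gamma> (p \<oplus>\<^sub>p (w1 + w2)) (q \<oplus>\<^sub>p w2)"
    using conjugate_shift[OF conjugate_sym[OF assms(1) conj[OF E(1)]] w(3)]
    by (simp add: shift_shift)
  then have d: "conjugate \<Gamma> p (q \<oplus>\<^sub>p w2)"
    using conjugate_trans[OF conjugate_shift_multiple[OF conj[OF E(2)] w(1)]] w(4) by simp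
  have "conjugate \<Gamma> (p \<oplus>\<^sub>p w1) (p \<oplus>\<^sub>p w1 \<oplus>\<^sub>p w)"
    using conjugate_shift[OF conj[OF E(2)] w(2)] by (simp add: shift_shift add.commute)
  then have "conjugate \<Gamma> (p \<oplus>\<^sub>p w1) (q \<oplus>\<^sub>p w)"
    by (rule conjugate_trans)
      (rule conjugate_shift[OF conjugate_sym[OF assms(1) conj[OF E(1)]] w(1)])
  then have e: "conjugate \<Gamma> q (q \<oplus>\<^sub>p w)"
    by (rule conjugate_trans[OF conj[OF E(1)]])
  show ?thesis
    using E(3,4) d e
    by (intro conjugate_endpoints_if_unchanged_except[OF assms(1,2) U _ assms(4)])
      (auto simp: edge_between_def)
qed

lemma move_conjugate_subset:
  assumes "gbs_graph \<Gamma>" "gbs_graph \<Gamma>'" "move \<Gamma> \<Gamma>'" "conjugate \<Gamma>' p q"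
  shows "conjugate \<Gamma> p q"
proof (rule conjugate_if_edges_conjugate[OF _ _ _ assms(4)])
  obtain D where U: "unchanged_except D \<Gamma> \<Gamma>'"
    using assms(3) unfolding move_def edge_sign_change_def slide_def connection_def by blast
  then show "Verts \<Gamma>' = Verts \<Gamma>"
    by (simp add: unchanged_except_def)
  show "Apos \<Gamma>' = Apos \<Gamma>"
    using move_Apos move_sym assms(1-3) by blast
  fix e assume "e \<in> Edges \<Gamma>'"
  then have e: "e \<in> Edges \<Gamma>"
    using U by (simp add: unchanged_except_def)
  from assms(3) show "conjugate \<Gamma> (iota \<Gamma>' e) (tau \<Gamma>' e)"
    unfolding move_def
    by (elim disjE) (erule edge_sign_change_conjugate[OF assms(1,2) _ e]
        slide_conjugate[OF assms(1,2) _ e] connection_conjugate[OF assms(1,2) _ e])+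
qed

lemma
  assumes "gbs_graph \<Gamma>" "gbs_graph \<Gamma>'" "move \<Gamma> \<Gamma>'"
  shows move_Apos_eq: "Apos \<Gamma>' = Apos \<Gamma>"
    and move_point_le_eq: "point_le \<Gamma>' = point_le \<Gamma>"
    and move_quasi_conj_eq: "quasi_conj \<Gamma>' = quasi_conj \<Gamma>"
    and move_min_qc_eq: "min_qc \<Gamma>' = min_qc \<Gamma>"
proof -
  show A: "Apos \<Gamma>' = Apos \<Gamma>"
    using move_Apos move_sym assms by blast
  then show le: "point_le \<Gamma>' = point_le \<Gamma>"
    by (simp add: point_le_def fun_eq_iff)
  have "Verts \<Gamma>' = Verts \<Gamma>"
    using assms(3) unfolding move_def edge_sign_change_def slide_def connection_def
      unchanged_except_def by blast
  then have "points \<Gamma>' = points \<Gamma>"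
    by (simp add: points_def A)
  moreover have "conjugate \<Gamma>' = conjugate \<Gamma>"
  proof (intro ext iffI)
    show "conjugate \<Gamma> p q" if "conjugate \<Gamma>' p q" for p q
      by (rule move_conjugate_subset[OF assms that])
    show "conjugate \<Gamma>' p q" if "conjugate \<Gamma> p q" for p q
      by (rule move_conjugate_subset[OF assms(2,1) move_sym[OF assms] that])
  qed
  ultimately show "quasi_conj \<Gamma>' = quasi_conj \<Gamma>"
    by (simp add: quasi_conj_def conj_le_def le fun_eq_iff)
  show "min_qc \<Gamma>' = min_qc \<Gamma>"
    by (simp add: min_qc_def le fun_eq_iff)
qed

text \<open>
  Quasi-conjugacy is the same before and after a move, and some endpoint or its translate by
  \<open>eps\<close> is common to both graphs.
\<close>

lemma move_qc_class_eq:
  assumes "gbs_graph \<Gamma>" "gbs_graph \<Gamma>'" "move \<Gamma> \<Gamma>'" "one_qc_class \<Gamma> Q" "one_qc_class \<Gamma>' Q'"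
  shows "Q' = Q"
proof -
  have qc: "qc_class \<Gamma> Q" "qc_class \<Gamma>' Q'"
    and inQ: "\<And>e. e \<in> Edges \<Gamma> \<Longrightarrow> iota \<Gamma> e \<in> Q"
    and inQ': "\<And>e. e \<in> Edges \<Gamma>' \<Longrightarrow> iota \<Gamma>' e \<in> Q'"
    using assms(4,5) by (simp_all add: one_qc_class_def)
  have "\<exists>p. p \<in> Q \<and> p \<in> Q'"
    using assms(3) unfolding move_def
  proof (elim disjE)
    assume "edge_sign_change \<Gamma> \<Gamma>'"
    then obtain e p where "e \<in> Edges \<Gamma>" "iota \<Gamma> e = p" "e \<in> Edges \<Gamma>'" "iota \<Gamma>' e = p \<oplus>\<^sub>p eps"
      unfolding edge_sign_change_def edge_between_def by blast
    then have "p \<in> Q" "p \<oplus>\<^sub>p eps \<in> Q'"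
      using inQ inQ' by force+
    moreover from this have "p \<in> Q'"
      using qc_class_at_point[OF qc(2), of "p \<oplus>\<^sub>p eps" p] by (simp add: at_point_def)
    ultimately show ?thesis by blast
  next
    assume "slide \<Gamma> \<Gamma>'"
    then obtain e p q where "edge_between \<Gamma> e p q" "edge_between \<Gamma>' e p q"
      unfolding slide_def by blast
    then have "p \<in> Q" "p \<in> Q'"
      using inQ[of e] inQ'[of e] by (auto simp: edge_between_def)
    then show ?thesis by blast
  next
    assume "connection \<Gamma> \<Gamma>'"
    then obtain d e p q q' where "edge_between \<Gamma> e p q" "edge_between \<Gamma>' d p q'"
      unfolding connection_def by blast
    then have "p \<in> Q" "p \<in> Q'"
      using inQ[of e] inQ'[of d] by (auto simp: edge_between_def)
    then show ?thesis by blast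
  qed
  then show ?thesis
    using qc_class_eqI[OF qc move_quasi_conj_eq[OF assms(1-3)]] by blast
qed

section \<open>The effect of a move on rigid cycles\<close>

locale clean_gbs_pair = A: clean_gbs \<Gamma> Q + B: clean_gbs \<Gamma>' Q
  for \<Gamma> \<Gamma>' :: "('v, 'e) gbs" and Q :: "'v point set" +
  assumes Apos_eq: "Apos \<Gamma>' = Apos \<Gamma>" and min_eq: "min_qc \<Gamma>' Q = min_qc \<Gamma> Q"
begin

lemma point_le_eq: "point_le \<Gamma>' = point_le \<Gamma>"
  by (simp add: point_le_def Apos_eq fun_eq_iff)

lemma isolating_eq: "isolating \<Gamma>' Q = isolating \<Gamma> Q"
  by (simp add: isolating_def min_eq point_le_eq fun_eq_iff)

lemma swap: "clean_gbs_pair \<Gamma>' \<Gamma> Q"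
  by unfold_locales (simp_all add: Apos_eq min_eq)

text \<open>
  An edge that is not outgoing has an outgoing reverse, in both graphs; so it is enough to check the
  changed edges in one orientation.
\<close>

lemma outgoing_eqI:
  assumes U: "unchanged_except D \<Gamma> \<Gamma>'" and D: "D \<subseteq> outgoing \<Gamma> Q" "D \<subseteq> outgoing \<Gamma>' Q"
  shows "outgoing \<Gamma>' Q = outgoing \<Gamma> Q"
proof -
  have "e \<in> outgoing \<Gamma>' Q \<longleftrightarrow> e \<in> outgoing \<Gamma> Q" if e: "e \<in> Edges \<Gamma>" for e
  proof -
    have e': "e \<in> Edges \<Gamma>'" "bar \<Gamma>' e = bar \<Gamma> e"
      using U e by (simp_all add: unchanged_except_def)
    consider "e \<in> D" | "bar \<Gamma> e \<in> D" | "e \<notin> D" "bar \<Gamma> e \<notin> D"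
      by blast
    then show ?thesis
    proof cases
      case 1
      then show ?thesis using D by blast
    next
      case 2
      then show ?thesis
        using D A.outgoing_iff_tau[OF e] B.outgoing_iff_tau[OF e'(1)] e'(2) by auto
    next
      case 3
      then show ?thesis
        using endpoints_unchanged(1)[OF U e] e e' min_eq by (simp add: outgoing_def)
    qed
  qed
  moreover have "Edges \<Gamma>' = Edges \<Gamma>"
    using U by (simp add: unchanged_except_def)
  ultimately show ?thesis
    unfolding outgoing_def by blast
qed

lemma outgoing_unchanged:
  assumes "unchanged_except D \<Gamma> \<Gamma>'" "D \<subseteq> outgoing \<Gamma> Q" "e \<in> outgoing \<Gamma> Q" "e \<notin> D"
  shows "iota \<Gamma>' e = iota \<Gamma> e" "tau \<Gamma>' e = tau \<Gamma> e"
proof -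
  have e: "e \<in> Edges \<Gamma>"
    using assms(3) by (simp add: outgoing_def)
  then have "bar \<Gamma> e \<notin> D"
    using A.outgoing_iff_tau assms(2,3) by blast
  then show "iota \<Gamma>' e = iota \<Gamma> e" "tau \<Gamma>' e = tau \<Gamma> e"
    using endpoints_unchanged[OF assms(1) e assms(4)] by simp_all
qed

lemma rigid_list_transfer:
  assumes es: "rigid_list \<Gamma> Q es" and out: "outgoing \<Gamma>' Q = outgoing \<Gamma> Q"
    and leads: "\<And>e f. e \<in> set es \<Longrightarrow> f \<in> set es \<Longrightarrow> leads_to \<Gamma> e f \<Longrightarrow> leads_to \<Gamma>' e f"
    and rise: "total_rise \<Gamma>' (set es) = total_rise \<Gamma> (set es)"
  shows "rigid_list \<Gamma>' Q es"
proof -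
  have "list_all2 (leads_to \<Gamma>) es (rotate1 es)"
    using es by (simp add: rigid_list_def)
  then have "list_all2 (leads_to \<Gamma>') es (rotate1 es)"
    by (rule list.rel_mono_strong) (use leads in auto)
  then show ?thesis
    using es by (simp add: rigid_list_def isolating_eq out rise)
qed

lemma edge_sign_change_rigid_sets:
  assumes "edge_sign_change \<Gamma> \<Gamma>'" "C \<in> rigid_sets \<Gamma> Q"
  shows "C \<in> rigid_sets \<Gamma>' Q" "total_rise \<Gamma>' C = total_rise \<Gamma> C"
proof -
  \<comment> \<open>Sign changes are symmetric in the two ends of an edge: orient it to start at its minimal end.\<close>
  obtain e p q where E: "edge_between \<Gamma> e p q" "edge_between \<Gamma>' e (p \<oplus>\<^sub>p eps) (q \<oplus>\<^sub>p eps)"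
    and U: "unchanged_except {e} \<Gamma> \<Gamma>'" and e: "e \<in> outgoing \<Gamma> Q"
  proof -
    obtain e p q where E: "edge_between \<Gamma> e p q" "edge_between \<Gamma>' e (p \<oplus>\<^sub>p eps) (q \<oplus>\<^sub>p eps)"
      and U: "unchanged_except {e} \<Gamma> \<Gamma>'"
      using assms(1) unfolding edge_sign_change_def by blast
    then have e: "e \<in> Edges \<Gamma>" and bar: "bar \<Gamma>' e = bar \<Gamma> e"
      by (simp_all add: edge_between_def unchanged_except_def)
    show thesis
    proof (cases "e \<in> outgoing \<Gamma> Q")
      case True
      then show thesis using that E U by blast
    next
      case False
      then have "bar \<Gamma> e \<in> outgoing \<Gamma> Q"
        using A.outgoing_iff_tau e by blast
      then show thesis
        using that[OF edge_between_bar[OF A.gbs E(1)]] edge_between_bar[OF B.gbs E(2)]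
          unchanged_except_bar[OF A.gbs U] bar by simp
    qed
  qed
  have near: "iota \<Gamma>' f \<in> at_point (iota \<Gamma> f)" "tau \<Gamma>' f \<in> at_point (tau \<Gamma> f)"
    "snd (tau \<Gamma>' f) - snd (iota \<Gamma>' f) = snd (tau \<Gamma> f) - snd (iota \<Gamma> f)"
    if "f \<in> outgoing \<Gamma> Q" for f
    using E outgoing_unchanged[OF U _ that] e
    by (cases "f = e"; simp add: edge_between_def at_point_def)+
  have out: "outgoing \<Gamma>' Q = outgoing \<Gamma> Q"
  proof (rule outgoing_eqI[OF U])
    have "iota \<Gamma>' e \<in> min_qc \<Gamma> Q"
      using min_qc_at_point[OF A.qc _ near(1)[OF e]] e by (simp add: outgoing_def)
    then show "{e} \<subseteq> outgoing \<Gamma>' Q"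
      using E(2) by (simp add: outgoing_def edge_between_def min_eq)
  qed (use e in simp)
  have leads: "leads_to \<Gamma>' f g" if "f \<in> outgoing \<Gamma> Q" "g \<in> outgoing \<Gamma> Q" "leads_to \<Gamma> f g" for f g
    using near(2)[OF that(1)] near(1)[OF that(2)] that(3) point_le_trans
    unfolding leads_to_def point_le_eq at_point_iff_point_le[of _ _ \<Gamma>] by blast
  obtain es where es: "rigid_list \<Gamma> Q es" "C = set es"
    using assms(2) by (auto simp: rigid_sets_def)
  then have sub: "set es \<subseteq> outgoing \<Gamma> Q"
    by (simp add: rigid_list_def)
  show rise: "total_rise \<Gamma>' C = total_rise \<Gamma> C"
    unfolding total_rise_def es(2) by (rule sum.cong) (use sub near(3) in auto)
  have "rigid_list \<Gamma>' Q es"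
    by (rule rigid_list_transfer[OF es(1) out]) (use sub leads rise es(2) in auto)
  then show "C \<in> rigid_sets \<Gamma>' Q"
    using es(2) by (auto simp: rigid_sets_def)
qed

text \<open>
  In a connection both edges leave minimal points. No rigid cycle contains \<open>d\<close>: it would have to
  continue with \<open>e\<close>, and then with \<open>e\<close> for ever. For the same reason \<open>e\<close> can only occur in a cycle of
  length one, whose vector \<open>w\<close> is the same on both sides.
\<close>

lemma connection_rigid_sets:
  assumes "connection \<Gamma> \<Gamma>'" "C \<in> rigid_sets \<Gamma> Q"
  shows "C \<in> rigid_sets \<Gamma>' Q" "total_rise \<Gamma>' C = total_rise \<Gamma> C"
proof -
  obtain d e p q w w1 w2
    where w: "w \<in> Apos \<Gamma>" "w1 \<in> Apos \<Gamma>" and d: "d \<notin> {e, bar \<Gamma> e}"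
    and E: "edge_between \<Gamma> d q (p \<oplus>\<^sub>p w1)" "edge_between \<Gamma> e p (p \<oplus>\<^sub>p w)"
      "edge_between \<Gamma>' d p (q \<oplus>\<^sub>p w2)" "edge_between \<Gamma>' e q (q \<oplus>\<^sub>p w)"
    and U: "unchanged_except {d, e} \<Gamma> \<Gamma>'"
    using assms(1) unfolding connection_def by blast
  have ends: "e \<in> Edges \<Gamma>" "iota \<Gamma> e = p" "tau \<Gamma> e = p \<oplus>\<^sub>p w"
    "d \<in> Edges \<Gamma>" "iota \<Gamma> d = q" "tau \<Gamma> d = p \<oplus>\<^sub>p w1"
    "e \<in> Edges \<Gamma>'" "iota \<Gamma>' e = q" "tau \<Gamma>' e = q \<oplus>\<^sub>p w"
    "d \<in> Edges \<Gamma>'" "iota \<Gamma>' d = p"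
    using E by (simp_all add: edge_between_def)
  have leads: "leads_to \<Gamma> e e" "leads_to \<Gamma> d e" "leads_to \<Gamma>' e e"
    using ends w point_le_shift Apos_eq unfolding leads_to_def by metis+
  have "iota \<Gamma> e \<in> min_qc \<Gamma> Q" if "tau \<Gamma> e \<in> min_qc \<Gamma> Q"
    using min_qc_downward(1)[OF that] leads(1) A.endpoints_in_Q(1)[OF ends(1)]
    by (simp add: leads_to_def)
  then have e: "e \<in> outgoing \<Gamma> Q"
    using A.outgoing_or_bar_outgoing[OF ends(1)] iota_bar[OF A.gbs] ends(1)
    by (auto simp: outgoing_def)
  have d_out: "d \<in> outgoing \<Gamma> Q"
    using A.outgoing_if_head_above[OF e ends(4) d leads(2)] .
  have D: "{d, e} \<subseteq> outgoing \<Gamma> Q" "{d, e} \<subseteq> outgoing \<Gamma>' Q"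
    using e d_out ends min_eq by (auto simp: outgoing_def)
  note out = outgoing_eqI[OF U D]
  note same = outgoing_unchanged[OF U D(1)]
  have e_only: "C = {e}" if "e \<in> C"
  proof -
    obtain xs where xs: "rigid_list \<Gamma> Q (e # xs)" "set (e # xs) = C"
      using A.rigid_set_start[OF assms(2) \<open>e \<in> C\<close>] by blast
    then have "rotate1 (e # xs) ! 0 = e"
      by (intro A.rigid_list_next) (use e leads(1) in auto)
    then have "xs = []"
      using xs(1) by (cases xs) (auto simp: rigid_list_def)
    then show ?thesis
      using xs(2) by simp
  qed
  have d_not: "d \<notin> C"
  proof
    assume "d \<in> C"
    then obtain xs where xs: "rigid_list \<Gamma> Q (d # xs)" "set (d # xs) = C"
      using A.rigid_set_start[OF assms(2)] by blast
    then have "rotate1 (d # xs) ! 0 = e"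
      by (intro A.rigid_list_next) (use e leads(2) in auto)
    then have "e \<in> C"
      using xs(2) by (cases xs) auto
    then show False
      using e_only \<open>d \<in> C\<close> d by blast
  qed
  obtain es where es: "rigid_list \<Gamma> Q es" "C = set es"
    using assms(2) by (auto simp: rigid_sets_def)
  then have sub: "C \<subseteq> outgoing \<Gamma> Q"
    by (simp add: rigid_list_def)
  have unch: "iota \<Gamma>' f = iota \<Gamma> f \<and> tau \<Gamma>' f = tau \<Gamma> f" if "e \<notin> C" "f \<in> C" for f
    using that sub d_not same[of f] by blast
  show rise: "total_rise \<Gamma>' C = total_rise \<Gamma> C"
  proof (cases "e \<in> C")
    case True
    then show ?thesis
      using e_only ends by (simp add: total_rise_def)
  next
    case False
    then show ?thesis
      unfolding total_rise_def using unch by (intro sum.cong) auto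
  qed
  have "rigid_list \<Gamma>' Q es"
  proof (rule rigid_list_transfer[OF es(1) out])
    fix f g assume fg: "f \<in> set es" "g \<in> set es" "leads_to \<Gamma> f g"
    show "leads_to \<Gamma>' f g"
    proof (cases "e \<in> C")
      case True
      then show ?thesis
        using e_only fg leads(3) es(2) by auto
    next
      case False
      then show ?thesis
        using unch fg es(2) by (simp add: leads_to_def point_le_eq)
    qed
  qed (use rise es(2) in simp)
  then show "C \<in> rigid_sets \<Gamma>' Q"
    using es(2) by (auto simp: rigid_sets_def)
qed

end

text \<open>
  The slides over an edge that leaves a minimal point \<open>p\<close>. They shorten the rigid cycles through \<open>d\<close>
  by taking out \<open>e\<close>.
\<close>

locale slide_at_minimum = clean_gbs_pair \<Gamma> \<Gamma>' Q
  for \<Gamma> \<Gamma>' :: "('v, 'e) gbs" and Q :: "'v point set" +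
  fixes d e p q r a
  assumes a: "a \<in> Apos \<Gamma>" and d_other: "d \<notin> {e, bar \<Gamma> e}"
    and before: "edge_between \<Gamma> e p q" "edge_between \<Gamma> d r (p \<oplus>\<^sub>p a)"
    and after: "edge_between \<Gamma>' e p q" "edge_between \<Gamma>' d r (q \<oplus>\<^sub>p a)"
    and U: "unchanged_except {e, d} \<Gamma> \<Gamma>'"
    and p_min: "p \<in> min_qc \<Gamma> Q"
begin

lemma ends:
  "e \<in> Edges \<Gamma>" "iota \<Gamma> e = p" "tau \<Gamma> e = q" "d \<in> Edges \<Gamma>" "iota \<Gamma> d = r" "tau \<Gamma> d = p \<oplus>\<^sub>p a"
  "e \<in> Edges \<Gamma>'" "iota \<Gamma>' e = p" "tau \<Gamma>' e = q" "d \<in> Edges \<Gamma>'" "iota \<Gamma>' d = r"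
  "tau \<Gamma>' d = q \<oplus>\<^sub>p a"
  using before after by (simp_all add: edge_between_def)

lemma d_leads_to_e: "leads_to \<Gamma> d e"
  using ends a point_le_shift by (simp add: leads_to_def)

lemma outgoing_de: "e \<in> outgoing \<Gamma> Q" "d \<in> outgoing \<Gamma> Q"
proof -
  show e: "e \<in> outgoing \<Gamma> Q"
    using p_min ends by (simp add: outgoing_def)
  show "d \<in> outgoing \<Gamma> Q"
    using A.outgoing_if_head_above[OF e ends(4) d_other d_leads_to_e] .
qed

lemma outgoing_eq: "outgoing \<Gamma>' Q = outgoing \<Gamma> Q"
  using outgoing_de ends min_eq by (intro outgoing_eqI[OF U]) (auto simp: outgoing_def)

lemma same_ends:
  assumes "f \<in> outgoing \<Gamma> Q"
  shows "iota \<Gamma>' f = iota \<Gamma> f" "f \<noteq> d \<Longrightarrow> tau \<Gamma>' f = tau \<Gamma> f"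
  using outgoing_unchanged[OF U _ assms] outgoing_de ends by (cases "f = d"; cases "f = e"; simp)+

lemma leads_to_eq:
  assumes "f \<in> outgoing \<Gamma> Q" "g \<in> outgoing \<Gamma> Q" "f \<noteq> d"
  shows "leads_to \<Gamma>' f g \<longleftrightarrow> leads_to \<Gamma> f g"
  using same_ends assms by (simp add: leads_to_def point_le_eq)

lemma leads_to_d:
  assumes "g \<in> outgoing \<Gamma> Q" "leads_to \<Gamma> e g"
  shows "leads_to \<Gamma>' d g"
  using assms same_ends(1) ends point_le_trans[OF _ point_le_shift[OF a]]
  by (simp add: leads_to_def point_le_eq)

lemma total_rise_eq:
  assumes "C \<subseteq> outgoing \<Gamma> Q" "d \<notin> C"
  shows "total_rise \<Gamma>' C = total_rise \<Gamma> C"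
  unfolding total_rise_def
proof (rule sum.cong)
  fix f assume "f \<in> C"
  then have "f \<in> outgoing \<Gamma> Q" "f \<noteq> d"
    using assms by auto
  then show "snd (tau \<Gamma>' f) - snd (iota \<Gamma>' f) = snd (tau \<Gamma> f) - snd (iota \<Gamma> f)"
    by (simp add: same_ends)
qed simp

lemma total_rise_insert:
  assumes "C \<subseteq> outgoing \<Gamma> Q" "d \<notin> C" "e \<notin> C"
  shows "total_rise \<Gamma>' (insert d C) = total_rise \<Gamma> (insert d (insert e C))"
proof -
  have "finite C"
    using assms(1) finite_Edges[OF A.gbs] finite_subset by (fastforce simp: outgoing_def)
  then show ?thesis
    using assms d_other total_rise_eq[OF assms(1,2)] ends
    by (simp add: total_rise_def algebra_simps)
qed

lemma list_all2_leads_to_tail: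
  assumes "set (ys @ zs) \<subseteq> outgoing \<Gamma> Q" "d \<notin> set ys"
  shows "list_all2 (leads_to \<Gamma>') ys zs \<longleftrightarrow> list_all2 (leads_to \<Gamma>) ys zs"
  using assms leads_to_eq by (intro list.rel_cong) auto

lemma rigid_list_contract:
  assumes "rigid_list \<Gamma> Q (d # xs)"
  obtains ys where "xs = e # ys" "rigid_list \<Gamma>' Q (d # ys)"
    "total_rise \<Gamma>' (set (d # ys)) = total_rise \<Gamma> (set (d # xs))"
proof -
  have "rotate1 (d # xs) ! 0 = e"
    by (intro A.rigid_list_next[OF assms]) (use outgoing_de d_leads_to_e in auto)
  then obtain ys where ys: "xs = e # ys"
    using d_other by (cases xs) auto
  have out: "set (d # xs) \<subseteq> outgoing \<Gamma> Q" and dist: "distinct (d # xs)"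
    and chain: "list_all2 (leads_to \<Gamma>) (e # ys) (ys @ [d])"
    using assms by (simp_all add: rigid_list_def ys)
  have rise: "total_rise \<Gamma>' (set (d # ys)) = total_rise \<Gamma> (set (d # xs))"
    using total_rise_insert[of "set ys"] out dist by (simp add: ys)
  obtain z zs where z: "ys @ [d] = z # zs"
    by (cases ys) auto
  have "set (z # zs) \<subseteq> outgoing \<Gamma> Q"
    using out unfolding z[symmetric] by (auto simp: ys)
  then have "leads_to \<Gamma>' d z" "list_all2 (leads_to \<Gamma>') ys zs"
    using chain z leads_to_d list_all2_leads_to_tail[of ys zs] out dist by (auto simp: ys)
  then have "rigid_list \<Gamma>' Q (d # ys)"
    using assms rise z dist out by (simp add: rigid_list_def outgoing_eq isolating_eq ys)
  then show thesis
    using that ys rise by blast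
qed

text \<open>
  Conversely, \<open>q\<close> lies above some minimal point; the edge \<open>f\<close> that starts there is the only possible
  successor of \<open>d\<close> after the slide, and \<open>e\<close> leads to it as well. If \<open>e\<close> were in the same cycle, then \<open>f\<close>
  would have two predecessors. So \<open>e\<close> can be inserted between \<open>d\<close> and \<open>f\<close>.
\<close>

lemma rigid_list_expand:
  assumes "rigid_list \<Gamma>' Q (d # ys)"
  shows "e \<notin> set ys" "rigid_list \<Gamma> Q (d # e # ys)"
proof -
  obtain f where f: "f \<in> outgoing \<Gamma> Q" "point_le \<Gamma> (iota \<Gamma> f) q"
    using A.exists_outgoing_below A.endpoints_in_Q(2) ends by metis
  have ef: "leads_to \<Gamma> e f" "leads_to \<Gamma>' e f" "leads_to \<Gamma>' d f"
  proof -
    show 1: "leads_to \<Gamma> e f"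
      using f(2) ends by (simp add: leads_to_def)
    then show "leads_to \<Gamma>' e f"
      using leads_to_eq[OF outgoing_de(1) f(1)] d_other by auto
    show "leads_to \<Gamma>' d f"
      by (rule leads_to_d[OF f(1) 1])
  qed
  have next_d: "rotate1 (d # ys) ! 0 = f"
    by (intro B.rigid_list_next[OF assms]) (use ef f outgoing_eq in auto)
  show e: "e \<notin> set ys"
  proof
    assume "e \<in> set ys"
    then obtain j where j: "j < length ys" "ys ! j = e"
      by (metis in_set_conv_nth)
    then have "rotate1 (d # ys) ! Suc j = f"
      by (intro B.rigid_list_next[OF assms]) (use ef f outgoing_eq in auto)
    moreover have "distinct (rotate1 (d # ys))"
      using assms unfolding rigid_list_def distinct1_rotate by blast
    ultimately show False
      using next_d j(1) nth_eq_iff_index_eq[of "rotate1 (d # ys)" "Suc j" 0] by simp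
  qed
  have out: "set (d # ys) \<subseteq> outgoing \<Gamma> Q" and dist: "distinct (d # ys)"
    and chain: "list_all2 (leads_to \<Gamma>') (d # ys) (ys @ [d])"
    using assms by (simp_all add: rigid_list_def outgoing_eq)
  obtain zs where z: "ys @ [d] = f # zs"
    using next_d by (cases ys) auto
  have "set (f # zs) \<subseteq> outgoing \<Gamma> Q"
    using out unfolding z[symmetric] by auto
  then have "list_all2 (leads_to \<Gamma>) ys zs"
    using chain z list_all2_leads_to_tail[of ys zs] out dist by auto
  then have "list_all2 (leads_to \<Gamma>) (d # e # ys) (e # ys @ [d])"
    using z ef d_leads_to_e by simp
  moreover have "total_rise \<Gamma> (set (d # e # ys)) = total_rise \<Gamma>' (set (d # ys))"
    using total_rise_insert[of "set ys"] out dist e by simp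
  ultimately show "rigid_list \<Gamma> Q (d # e # ys)"
    using assms out dist e d_other outgoing_de by (auto simp: rigid_list_def isolating_eq)
qed

lemma rigid_sets_avoiding_d:
  assumes "d \<notin> C"
  shows "C \<in> rigid_sets \<Gamma>' Q \<longleftrightarrow> C \<in> rigid_sets \<Gamma> Q"
proof -
  have "rigid_list \<Gamma>' Q es \<longleftrightarrow> rigid_list \<Gamma> Q es" if "set es = C" for es
  proof (cases "C \<subseteq> outgoing \<Gamma> Q")
    case True
    then show ?thesis
      using that assms list_all2_leads_to_tail[of es "rotate1 es"] total_rise_eq[of C]
      by (simp add: rigid_list_def outgoing_eq isolating_eq)
  next
    case False
    then show ?thesis
      using that by (simp add: rigid_list_def outgoing_eq)
  qed
  then show ?thesis
    unfolding rigid_sets_def by blast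
qed

lemma rigid_vectors_eq: "rigid_vectors \<Gamma>' Q = rigid_vectors \<Gamma> Q"
proof -
  let ?f = "\<lambda>C. if d \<in> C then C - {e} else C"
  let ?g = "\<lambda>C. if d \<in> C then insert e C else C"
  have contract: "e \<in> C \<and> C - {e} \<in> rigid_sets \<Gamma>' Q \<and> total_rise \<Gamma>' (C - {e}) = total_rise \<Gamma> C"
    if C: "C \<in> rigid_sets \<Gamma> Q" "d \<in> C" for C
  proof -
    obtain xs where xs: "rigid_list \<Gamma> Q (d # xs)" "set (d # xs) = C"
      using A.rigid_set_start[OF C] by blast
    obtain ys where ys: "xs = e # ys" "rigid_list \<Gamma>' Q (d # ys)"
      "total_rise \<Gamma>' (set (d # ys)) = total_rise \<Gamma> (set (d # xs))"
      using rigid_list_contract[OF xs(1)] by blast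
    have "set (d # ys) = C - {e}"
      using xs ys(1) by (auto simp: rigid_list_def)
    moreover have "e \<in> C"
      using xs(2) ys(1) by auto
    ultimately show ?thesis
      using ys(2,3) xs(2) unfolding rigid_sets_def by (metis image_eqI mem_Collect_eq)
  qed
  have expand: "e \<notin> C \<and> insert e C \<in> rigid_sets \<Gamma> Q" if C: "C \<in> rigid_sets \<Gamma>' Q" "d \<in> C" for C
  proof -
    obtain ys where ys: "rigid_list \<Gamma>' Q (d # ys)" "set (d # ys) = C"
      using B.rigid_set_start[OF C] by blast
    note e = rigid_list_expand[OF ys(1)]
    have "set (d # e # ys) = insert e C"
      using ys(2) by auto
    moreover have "e \<notin> C"
      using e(1) ys(2) d_other by auto
    ultimately show ?thesis
      using e(2) unfolding rigid_sets_def by (metis image_eqI mem_Collect_eq)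
  qed
  have de: "d \<noteq> e"
    using d_other by blast
  have "bij_betw ?f (rigid_sets \<Gamma> Q) (rigid_sets \<Gamma>' Q)"
  proof (rule bij_betw_byWitness[of _ ?g])
    show "\<forall>C \<in> rigid_sets \<Gamma> Q. ?g (?f C) = C"
      using contract de by auto
    show "\<forall>C \<in> rigid_sets \<Gamma>' Q. ?f (?g C) = C"
      using expand by auto
    show "?f ` rigid_sets \<Gamma> Q \<subseteq> rigid_sets \<Gamma>' Q"
      using contract rigid_sets_avoiding_d by auto
    show "?g ` rigid_sets \<Gamma>' Q \<subseteq> rigid_sets \<Gamma> Q"
      using expand rigid_sets_avoiding_d by auto
  qed
  moreover have "total_rise \<Gamma>' (?f C) = total_rise \<Gamma> C" if "C \<in> rigid_sets \<Gamma> Q" for C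
  proof (cases "d \<in> C")
    case True
    then show ?thesis using contract that by simp
  next
    case False
    moreover have "C \<subseteq> outgoing \<Gamma> Q"
      using that by (auto simp: rigid_sets_def rigid_list_def)
    ultimately show ?thesis
      using total_rise_eq by simp
  qed
  ultimately show ?thesis
    by (rule rigid_vectors_eqI[OF A.clean_gbs_axioms B.clean_gbs_axioms])
qed

end

context clean_gbs_pair
begin

lemma rigid_vectors_eq_if_same_sets:
  assumes "\<And>C. C \<in> rigid_sets \<Gamma> Q \<Longrightarrow> C \<in> rigid_sets \<Gamma>' Q \<and> total_rise \<Gamma>' C = total_rise \<Gamma> C"
    and "\<And>C. C \<in> rigid_sets \<Gamma>' Q \<Longrightarrow> C \<in> rigid_sets \<Gamma> Q"
  shows "rigid_vectors \<Gamma>' Q = rigid_vectors \<Gamma> Q"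
proof (rule rigid_vectors_eqI[OF A.clean_gbs_axioms B.clean_gbs_axioms])
  have "rigid_sets \<Gamma>' Q = rigid_sets \<Gamma> Q"
    using assms by blast
  then show "bij_betw id (rigid_sets \<Gamma> Q) (rigid_sets \<Gamma>' Q)"
    by simp
qed (use assms in simp)

lemma slide_rigid_vectors:
  assumes "slide \<Gamma> \<Gamma>'"
  shows "rigid_vectors \<Gamma>' Q = rigid_vectors \<Gamma> Q"
proof -
  obtain e d p q r a where a: "a \<in> Apos \<Gamma>" and d: "d \<notin> {e, bar \<Gamma> e}"
    and E: "edge_between \<Gamma> e p q" "edge_between \<Gamma> d r (p \<oplus>\<^sub>p a)"
      "edge_between \<Gamma>' e p q" "edge_between \<Gamma>' d r (q \<oplus>\<^sub>p a)"
    and U: "unchanged_except {e, d} \<Gamma> \<Gamma>'"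
    using assms unfolding slide_def by blast
  have e: "e \<in> Edges \<Gamma>" and bar: "bar \<Gamma>' e = bar \<Gamma> e"
    using E(1) U by (simp_all add: edge_between_def unchanged_except_def)
  show ?thesis
  proof (cases "p \<in> min_qc \<Gamma> Q")
    case True
    then interpret slide_at_minimum \<Gamma> \<Gamma>' Q d e p q r a
      using a d E U by unfold_locales auto
    show ?thesis
      by (rule rigid_vectors_eq)
  next
    case False
    \<comment> \<open>Then \<open>q\<close> is minimal, and the inverse slide goes over the reversed edge, which leaves \<open>q\<close>.\<close>
    then have "bar \<Gamma> e \<in> outgoing \<Gamma> Q"
      using A.outgoing_or_bar_outgoing[OF e] E(1) by (auto simp: outgoing_def edge_between_def)
    then have "q \<in> min_qc \<Gamma>' Q"
      using E(1) min_eq iota_bar[OF A.gbs] by (simp add: outgoing_def edge_between_def)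
    moreover have "edge_between \<Gamma>' (bar \<Gamma> e) q p"
      using edge_between_bar[OF B.gbs E(3)] bar by simp
    moreover have "d \<notin> {bar \<Gamma> e, bar \<Gamma>' (bar \<Gamma> e)}"
      using d bar_bar[OF B.gbs, of e] bar by auto
    moreover have "a \<in> Apos \<Gamma>'"
      using a Apos_eq by simp
    ultimately have "slide_at_minimum \<Gamma>' \<Gamma> Q d (bar \<Gamma> e) q p r a"
      using swap edge_between_bar[OF A.gbs E(1)] E(2,4)
        unchanged_except_sym[OF unchanged_except_bar[OF A.gbs U]]
      by (simp add: slide_at_minimum_def slide_at_minimum_axioms_def)
    then show ?thesis
      by (rule slide_at_minimum.rigid_vectors_eq[symmetric])
  qed
qed

lemma move_rigid_vectors:
  assumes "move \<Gamma> \<Gamma>'"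
  shows "rigid_vectors \<Gamma>' Q = rigid_vectors \<Gamma> Q"
  using assms unfolding move_def
proof (elim disjE)
  assume m: "edge_sign_change \<Gamma> \<Gamma>'"
  show ?thesis
    using edge_sign_change_rigid_sets[OF m]
      clean_gbs_pair.edge_sign_change_rigid_sets(1)[OF swap edge_sign_change_sym[OF m]]
    by (intro rigid_vectors_eq_if_same_sets) auto
next
  assume "slide \<Gamma> \<Gamma>'"
  then show ?thesis
    by (rule slide_rigid_vectors)
next
  assume m: "connection \<Gamma> \<Gamma>'"
  then have m': "connection \<Gamma>' \<Gamma>"
    by (rule connection_sym[rotated]) (simp add: Apos_eq)
  show ?thesis
    using connection_rigid_sets[OF m] clean_gbs_pair.connection_rigid_sets(1)[OF swap m']
    by (intro rigid_vectors_eq_if_same_sets) auto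
qed

end

section \<open>Invariance of the rigid vectors\<close>

theorem proposition5p18:
  fixes \<Gamma> \<Gamma>' :: "('v, 'e) gbs" and Q Q' :: "'v point set"
  assumes "gbs_graph \<Gamma>" and "totally_reduced \<Gamma>"
    and "one_qc_class \<Gamma> Q" and "supp_qc \<Gamma> Q \<noteq> {}"
    and "clean \<Gamma> Q" and "\<not> floating_pieces \<Gamma> Q"
    and "gbs_graph \<Gamma>'" and "one_qc_class \<Gamma>' Q'" and "clean \<Gamma>' Q'"
    and "edge_sign_change \<Gamma> \<Gamma>' \<or> slide \<Gamma> \<Gamma>' \<or> connection \<Gamma> \<Gamma>'"
  shows "rigid_vectors \<Gamma>' Q' = rigid_vectors \<Gamma> Q"
proof -
  have move: "move \<Gamma> \<Gamma>'"
    using assms(10) by (simp add: move_def)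
  note gbs = assms(1,7)
  have Q: "Q' = Q"
    by (rule move_qc_class_eq[OF gbs move assms(3,8)])
  have min: "min_qc \<Gamma>' Q = min_qc \<Gamma> Q"
    by (simp add: move_min_qc_eq[OF gbs move])
  have "Edges \<Gamma>' = Edges \<Gamma>" "\<And>e. e \<in> Edges \<Gamma> \<Longrightarrow> bar \<Gamma>' e = bar \<Gamma> e"
    using assms(10) unfolding edge_sign_change_def slide_def connection_def unchanged_except_def
    by blast+
  then have "(\<lambda>e. {e, bar \<Gamma>' e}) ` Edges \<Gamma>' = (\<lambda>e. {e, bar \<Gamma> e}) ` Edges \<Gamma>"
    by simp
  then have "\<not> floating_pieces \<Gamma>' Q"
    using assms(6) by (simp add: floating_pieces_def min)
  then interpret clean_gbs_pair \<Gamma> \<Gamma>' Q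
    using assms Q min move_Apos_eq[OF gbs move] by unfold_locales simp_all
  show ?thesis
    using move_rigid_vectors[OF move] by (simp add: Q)
qed

end
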